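(* Let $(X,d,\mu)$ and $(X',d',\mu')$ be locally doubling geodesic metric measure spaces satisfying the uniform ball size condition. Suppose that $\varphi:X\to X'$ is a strict quasi-isometry, that $1\le p<\infty$, and that $1\le r\le s\le\infty$. The following hold: (i) if $\mathcal{M}_\infty$ (on $X$) is bounded from $L^{p,r}(X)$ to $L^{p,s}(X)$, then $\mathcal{M}_\infty$ (on $X'$) is bounded from $L^{p,r}(X')$ to $L^{p,s}(X')$; (ii) if $\mathcal{N}_\infty$ (on $X$) is bounded from $L^{p,r}(X)$ to $L^{p,s}(X)$, then $\mathcal{N}_\infty$ (on $X'$) is bounded from $L^{p,r}(X')$ to $L^{p,s}(X')$.
   Context: All metric measure spaces $(X,d,\mu)$ satisfy $0<\mu(B)<\infty$ for every ball $B$; $B_r(x)$ is the open ball of centre $x$ and radius $r$. $X$ is geodesic if any two points $x,y$ are joined by a geodesic segment whose length is $d(x,y)$. $X$ is locally doubling if for every $s>0$ there is a constant $D_s$ with $\mu(B_{2r}(x))\le D_s\,\mu(B_r(x))$ for all $x\in X$, $0<r\le s$. $X$ satisfies the uniform ball size condition if $\inf_{x\in X}\mu(B_1(x))>0$ and $\sup_{x\in X}\mu(B_1(x))<\infty$. A map $\varphi:X\to X'$ is a strict quasi-isometry (also called strict rough isometry, or $1$-quasi-isometry) if $\sup_{x'\in X'}d'(\varphi(X),x')<\infty$ and there is $\beta\ge0$ such that $d(x,y)-\beta\le d'(\varphi(x),\varphi(y))\le d(x,y)+\beta$ for all $x,y\in X$. The operators are $$\mathcal{M}_\infty f(x)=\sup_{r>1}\frac{1}{\mu(B_r(x))}\int_{B_r(x)}|f|\,d\mu,\qquad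 \mathcal{N}_\infty f(x)=\sup_{B\ni x,\ r_B>1}\frac{1}{\mu(B)}\int_B|f|\,d\mu,$$ the latter supremum being over all open balls $B$ containing $x$ with radius $r_B>1$; on $X'$ they are defined in the same way using $d',\mu'$. Lorentz (quasi-)norms: for $1\le r<\infty$, $\|f\|_{L^{p,r}}=\big(r\int_0^\infty |\{|f|>\alpha\}|^{r/p}\alpha^{r-1}\,d\alpha\big)^{1/r}$, and $\|f\|_{L^{p,\infty}}=\sup_{\alpha>0}\alpha\,|\{|f|>\alpha\}|^{1/p}$, where $|\cdot|$ denotes the measure.
   Formalization: The case p = 1, r > 1 with X a single point and X' not a single point is excluded; there the claim is false, e.g. X a point, X' = [0,1] with Lebesgue measure, r = s = 2. *)

theory Defs
  imports "HOL-Analysis.Analysis"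
begin

section \<open>Metric measure spaces\<close>

text \<open>The metric space is the whole type; the measure lives on the Borel sets of the metric.\<close>

definition metric_measure_space :: "'a::metric_space measure \<Rightarrow> bool" where
  "metric_measure_space \<mu> \<longleftrightarrow>
     sets \<mu> = sets borel \<and>
     (\<forall>x r. r > 0 \<longrightarrow> 0 < emeasure \<mu> (ball x r) \<and> emeasure \<mu> (ball x r) < \<infinity>)"

text \<open>Segments are parametrised by arc length, so the length of the segment is
  automatically \<open>dist x y\<close>.\<close>

definition geodesic_segment :: "(real \<Rightarrow> 'a::metric_space) \<Rightarrow> 'a \<Rightarrow> 'a \<Rightarrow> bool" where
  "geodesic_segment \<gamma> x y \<longleftrightarrow>
     \<gamma> 0 = x \<and> \<gamma> (dist x y) = y \<and>
     (\<forall>s\<in>{0..dist x y}. \<forall>t\<in>{0..dist x y}. dist (\<gamma> s) (\<gamma> t) = \<bar>s - t\<bar>)"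

definition geodesic_space :: "'a::metric_space itself \<Rightarrow> bool" where
  "geodesic_space _ \<longleftrightarrow> (\<forall>x y::'a. \<exists>\<gamma>. geodesic_segment \<gamma> x y)"

definition locally_doubling :: "'a::metric_space measure \<Rightarrow> bool" where
  "locally_doubling \<mu> \<longleftrightarrow>
     (\<forall>s>0. \<exists>D::real. \<forall>x r. 0 < r \<and> r \<le> s \<longrightarrow>
        emeasure \<mu> (ball x (2 * r)) \<le> ennreal D * emeasure \<mu> (ball x r))"

definition uniform_ball_size :: "'a::metric_space measure \<Rightarrow> bool" where
  "uniform_ball_size \<mu> \<longleftrightarrow>
     (INF x. emeasure \<mu> (ball x 1)) > 0 \<and> (SUP x. emeasure \<mu> (ball x 1)) < \<infinity>"

definition strict_quasi_isometry :: "('a::metric_space \<Rightarrow> 'b::metric_space) \<Rightarrow> bool" where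
  "strict_quasi_isometry \<phi> \<longleftrightarrow>
     bdd_above (range (\<lambda>x'. infdist x' (range \<phi>))) \<and>
     (\<exists>\<beta>\<ge>0. \<forall>x y. dist x y - \<beta> \<le> dist (\<phi> x) (\<phi> y) \<and> dist (\<phi> x) (\<phi> y) \<le> dist x y + \<beta>)"

section \<open>Maximal operators at infinity\<close>

definition ball_average :: "'a::metric_space measure \<Rightarrow> ('a \<Rightarrow> complex) \<Rightarrow> 'a \<Rightarrow> real \<Rightarrow> ennreal" where
  "ball_average \<mu> f c r =
     (\<integral>\<^sup>+ y\<in>ball c r. ennreal (norm (f y)) \<partial>\<mu>) / emeasure \<mu> (ball c r)"

definition centred_maximal :: "'a::metric_space measure \<Rightarrow> ('a \<Rightarrow> complex) \<Rightarrow> 'a \<Rightarrow> ennreal" where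
  "centred_maximal \<mu> f x = (SUP r\<in>{1<..}. ball_average \<mu> f x r)"

text \<open>A ball is a pair of centre and radius: a set which is a ball for several choices
  of centre and radius is admitted as soon as one of these radii exceeds \<open>1\<close>.\<close>

definition uncentred_maximal :: "'a::metric_space measure \<Rightarrow> ('a \<Rightarrow> complex) \<Rightarrow> 'a \<Rightarrow> ennreal" where
  "uncentred_maximal \<mu> f x =
     (SUP (c, r)\<in>{(c, r). r > 1 \<and> x \<in> ball c r}. ball_average \<mu> f c r)"

section \<open>Lorentz spaces\<close>

text \<open>Real power of an extended nonnegative number, intended for exponents \<open>a > 0\<close>.\<close>

definition ennpowr :: "ennreal \<Rightarrow> real \<Rightarrow> ennreal" where
  "ennpowr x a = (if x = \<infinity> then \<infinity> else ennreal (enn2real x powr a))"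

text \<open>The functional is defined on \<open>[0, \<infinity>]\<close>-valued functions, since maximal functions may be
  infinite; a complex function \<open>f\<close> enters through \<open>\<bar>f\<bar>\<close>.\<close>

definition lorentz_norm :: "'a measure \<Rightarrow> real \<Rightarrow> ennreal \<Rightarrow> ('a \<Rightarrow> ennreal) \<Rightarrow> ennreal" where
  "lorentz_norm \<mu> p r u =
     (if r = \<infinity>
      then (SUP \<alpha>\<in>{0<..}. ennreal \<alpha> * ennpowr (emeasure \<mu> {x \<in> space \<mu>. u x > ennreal \<alpha>}) (1 / p))
      else ennpowr
        (r * (\<integral>\<^sup>+ \<alpha>\<in>{0<..}.
                ennpowr (emeasure \<mu> {x \<in> space \<mu>. u x > ennreal \<alpha>}) (enn2real r / p)
                * ennreal (\<alpha> powr (enn2real r - 1)) \<partial>lborel))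
        (1 / enn2real r))"

definition lorentz_space :: "'a measure \<Rightarrow> real \<Rightarrow> ennreal \<Rightarrow> ('a \<Rightarrow> complex) set" where
  "lorentz_space \<mu> p r =
     {f \<in> borel_measurable \<mu>. lorentz_norm \<mu> p r (\<lambda>x. ennreal (norm (f x))) < \<infinity>}"

definition lorentz_bounded ::
  "'a measure \<Rightarrow> real \<Rightarrow> ennreal \<Rightarrow> ennreal \<Rightarrow> (('a \<Rightarrow> complex) \<Rightarrow> 'a \<Rightarrow> ennreal) \<Rightarrow> bool" where
  "lorentz_bounded \<mu> p r s T \<longleftrightarrow>
     (\<exists>C::real. \<forall>f\<in>lorentz_space \<mu> p r.
        lorentz_norm \<mu> p s (T f) \<le> ennreal C * lorentz_norm \<mu> p r (\<lambda>x. ennreal (norm (f x))))"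

end

theory Submission
  imports Defs
begin

text \<open>
  Let \<open>\<psi>\<close> be a quasi-inverse of \<open>\<phi>\<close>. A function \<open>f\<close> on \<open>X'\<close> is replaced by the function on \<open>X\<close> which
  at \<open>w\<close> is the mass of \<open>\<bar>f\<bar>\<close> near \<open>\<phi> w\<close>. Since \<open>\<phi>\<close> distorts distances only by an additive constant,
  a ball of radius \<open>r > 1\<close> in \<open>X'\<close> corresponds to a ball of radius \<open>r + O(1)\<close> in \<open>X\<close>. Geodesics turn the
  enlargement by \<open>O(1)\<close> into a bounded factor in measure, so the maximal function of \<open>f\<close> near \<open>x'\<close> is
  controlled by that of the new function near \<open>\<psi> x'\<close>. Averaging at unit scale is bounded
  from \<open>L\<^sup>p\<^sup>,\<^sup>r(X')\<close> to \<open>L\<^sup>p\<^sup>,\<^sup>r(X)\<close> if \<open>p > 1\<close> or \<open>r = 1\<close>, by a dyadic decomposition of \<open>f\<close> into level sets.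
  For \<open>p = 1 < r\<close> this fails, but then the hypothesis fails as well unless \<open>X\<close> is a point: balls
  of \<open>X\<close> become arbitrarily small in measure, so \<open>L\<^sup>1\<^sup>,\<^sup>r\<close> does not embed locally into \<open>L\<^sup>1\<close>.
\<close>

subsection \<open>Lorentz norms and distribution functions\<close>

text \<open>For \<open>r > p\<close> the Lorentz functional is only a quasi-norm, so the comparisons
  avoid adding norms and go through distribution functions: if that of \<open>u\<close> at \<alpha>
  is at most a constant times the supremum over \<open>j\<close> of
  \<open>2 powr (\<theta> * j)\<close> times that of \<open>v\<close> at
  \<open>c * 2 ^ j * \<alpha>\<close>, with \<open>\<theta> < p\<close>, then the norms compare for
  every second exponent. For unit-scale averaging this is a restricted weak type estimate. If
  \<open>f\<close> has mass above \<alpha> in a 2-ball, some level set at height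
  \<open>c * 2 ^ j * \<alpha>\<close> has measure of order at least
  \<open>2 powr - (\<theta> * j)\<close> there; Chebyshev and the integral bound for its indicator
  then cost the factor \<open>2 powr (\<theta> * j)\<close>. Summing the levels forces
  \<open>\<theta> > 1\<close>, which leaves room below \<open>p\<close> exactly when
  \<open>p > 1\<close>; this is the obstacle at \<open>p = 1\<close>. Measures and integrals on the
  two spaces are always compared by one covering lemma, \<open>net_comparison\<close>, applied along
  \<phi> or \<psi>. Geodesics of \<open>X'\<close> pull points of an enlarged ball back into the
  ball; geodesics of \<open>X\<close> exclude atoms, which produces the small balls behind the case
  \<open>p = 1 < r\<close>.\<close>

lemma ennpowr_ennreal [simp]: "0 \<le> x \<Longrightarrow> ennpowr (ennreal x) a = ennreal (x powr a)"
  by (simp add: ennpowr_def)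

lemma ennpowr_top [simp]: "ennpowr top a = top"
  by (simp add: ennpowr_def)

lemma ennpowr_one [simp]: "ennpowr x 1 = x"
  by (cases x) auto

lemma ennpowr_mono: "x \<le> y \<Longrightarrow> 0 < a \<Longrightarrow> ennpowr x a \<le> ennpowr y a"
  by (cases x; cases y) (auto simp: powr_mono2 top_unique)

lemma ennpowr_ennpowr: "ennpowr (ennpowr x a) b = ennpowr x (a * b)"
  by (cases x) (auto simp: powr_powr)

lemma ennpowr_mult:
  "0 < k \<Longrightarrow> ennpowr (ennreal k * x) a = ennreal (k powr a) * ennpowr x a"
  by (cases x) (auto simp: powr_mult ennreal_mult'[symmetric] ennreal_mult_top)

text \<open>Each \<open>x j\<close> is at most the \<open>1 / a\<close>-th power of the right-hand
  side. A supremum, unlike a sum, can be compared term by term, so exponents on both sides of 1 are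
  covered.\<close>

lemma ennpowr_SUP_le_suminf:
  assumes "0 < a"
  shows "ennpowr (SUP j. x j) a \<le> (\<Sum>j. ennpowr (x j) a)"
proof -
  define y where "y = (\<Sum>j. ennpowr (x j) a)"
  have "x j \<le> ennpowr y (1 / a)" for j
  proof -
    have "ennpowr (x j) a \<le> y"
      using sum_le_suminf[of "\<lambda>j. ennpowr (x j) a" "{j}"] by (simp add: y_def)
    then have "ennpowr (ennpowr (x j) a) (1 / a) \<le> ennpowr y (1 / a)"
      using assms by (intro ennpowr_mono) auto
    then show ?thesis using assms by (simp add: ennpowr_ennpowr)
  qed
  then have "(SUP j. x j) \<le> ennpowr y (1 / a)" by (intro SUP_least)
  then have "ennpowr (SUP j. x j) a \<le> ennpowr (ennpowr y (1 / a)) a"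
    using assms by (intro ennpowr_mono)
  then show ?thesis using assms by (simp add: ennpowr_ennpowr y_def)
qed

lemma measurable_ennpowr [measurable]: "(\<lambda>x. ennpowr x a) \<in> borel_measurable borel"
  unfolding ennpowr_def by measurable

abbreviation distribution :: "'a measure \<Rightarrow> ('a \<Rightarrow> ennreal) \<Rightarrow> real \<Rightarrow> ennreal" where
  "distribution M u \<alpha> \<equiv> emeasure M {x \<in> space M. u x > ennreal \<alpha>}"

lemma distribution_antimono:
  assumes [measurable]: "u \<in> borel_measurable M" and "\<alpha> \<le> \<beta>"
  shows "distribution M u \<beta> \<le> distribution M u \<alpha>"
  by (intro emeasure_mono)
     (use assms(2) in \<open>auto intro: order.strict_trans1[OF ennreal_leI]\<close>)

lemma measurable_distribution [measurable]:
  assumes "u \<in> borel_measurable M"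
  shows "distribution M u \<in> borel_measurable borel"
proof (rule borel_measurableI_greater)
  fix t :: ennreal
  let ?S = "{\<alpha>. t < distribution M u \<alpha>}"
  \<comment> \<open>\<open>?S\<close> is a down-set because the distribution function is antitone;
    reflecting it makes its indicator monotone, hence Borel.\<close>
  have "mono (\<lambda>\<alpha>. indicator ?S (- \<alpha>) :: real)"
  proof (rule monoI)
    fix \<alpha> \<beta> :: real assume "\<alpha> \<le> \<beta>"
    then have "distribution M u (- \<alpha>) \<le> distribution M u (- \<beta>)"
      by (intro distribution_antimono assms) simp
    then show "(indicator ?S (- \<alpha>) :: real) \<le> indicator ?S (- \<beta>)"
      by (auto simp: indicator_def)
  qed
  from borel_measurable_mono[OF this]
  have "(\<lambda>\<alpha>. indicator ?S (- (- \<alpha>)) :: real) \<in> borel_measurable borel"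
    by measurable
  then show "{\<alpha> \<in> space borel. t < distribution M u \<alpha>} \<in> sets borel"
    by (simp add: borel_measurable_indicator_iff)
qed

lemma lorentz_norm_top:
  "lorentz_norm M p \<infinity> u = (SUP \<alpha>\<in>{0<..}. ennreal \<alpha> * ennpowr (distribution M u \<alpha>) (1 / p))"
  by (simp add: lorentz_norm_def)

lemma lorentz_norm_ennreal:
  "1 \<le> r \<Longrightarrow> lorentz_norm M p (ennreal r) u =
     ennpowr (ennreal r * (\<integral>\<^sup>+ \<alpha>\<in>{0<..}. ennpowr (distribution M u \<alpha>) (r / p)
       * ennreal (\<alpha> powr (r - 1)) \<partial>lborel)) (1 / r)"
  by (simp add: lorentz_norm_def)

lemma nn_integral_powr_scale:
  fixes D :: "real \<Rightarrow> ennreal"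
  assumes [measurable]: "D \<in> borel_measurable borel" and "0 < b"
  shows "(\<integral>\<^sup>+ \<alpha>\<in>{0<..}. D (b * \<alpha>) * ennreal (\<alpha> powr (r - 1)) \<partial>lborel)
     = ennreal (b powr - r) * (\<integral>\<^sup>+ \<alpha>\<in>{0<..}. D \<alpha> * ennreal (\<alpha> powr (r - 1)) \<partial>lborel)"
proof -
  let ?g = "\<lambda>\<alpha>. D \<alpha> * ennreal (\<alpha> powr (r - 1)) * indicator {0<..} \<alpha>"
  have "(\<integral>\<^sup>+ \<alpha>. ?g \<alpha> \<partial>lborel) = ennreal b * (\<integral>\<^sup>+ \<alpha>. ?g (b * \<alpha>) \<partial>lborel)"
    using nn_integral_real_affine[of ?g b 0] assms by simp
  also have "(\<integral>\<^sup>+ \<alpha>. ?g (b * \<alpha>) \<partial>lborel) =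
      (\<integral>\<^sup>+ \<alpha>. ennreal (b powr (r - 1)) * (D (b * \<alpha>) * ennreal (\<alpha> powr (r - 1)) * indicator {0<..} \<alpha>) \<partial>lborel)"
    using assms(2)
    by (intro nn_integral_cong)
       (auto simp: indicator_def zero_less_mult_iff powr_mult ennreal_mult mult_ac)
  also have "\<dots> = ennreal (b powr (r - 1)) * (\<integral>\<^sup>+ \<alpha>\<in>{0<..}. D (b * \<alpha>) * ennreal (\<alpha> powr (r - 1)) \<partial>lborel)"
    by (rule nn_integral_cmult) measurable
  finally have *: "(\<integral>\<^sup>+ \<alpha>. ?g \<alpha> \<partial>lborel) = ennreal (b powr r) * (\<integral>\<^sup>+ \<alpha>\<in>{0<..}. D (b * \<alpha>) * ennreal (\<alpha> powr (r - 1)) \<partial>lborel)"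
    using assms(2) by (simp add: mult.assoc[symmetric] ennreal_mult'[symmetric] powr_mult_base)
  show ?thesis unfolding * mult.assoc[symmetric]
    using assms(2) by (simp add: ennreal_mult'[symmetric] powr_add[symmetric])
qed

text \<open>In the \<open>j\<close>-th term the factor \<open>2\<^sup>\<theta>\<^sup>j\<close> costs \<open>2\<^sup>\<theta>\<^sup>j\<^sup>/\<^sup>p\<close> in the norm, while the dilation by \<open>2\<^sup>j\<close>
  gains \<open>2\<^sup>-\<^sup>j\<close>; this is why \<open>\<theta> < p\<close> makes the sum over \<open>j\<close> converge.\<close>

lemma lorentz_norm_le_of_distribution_le:
  fixes M :: "'a measure" and N :: "'b measure" and p \<theta> K c :: real and r :: ennreal
  assumes "1 \<le> p" "1 \<le> r" "\<theta> < p" "0 < K" "0 < c"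
  obtains C :: real where "0 < C"
    "\<And>u v. v \<in> borel_measurable N \<Longrightarrow>
       (\<And>\<alpha>. 0 < \<alpha> \<Longrightarrow> distribution M u \<alpha>
          \<le> ennreal K * (SUP j::nat. ennreal (2 powr (\<theta> * j)) * distribution N v (c * 2 ^ j * \<alpha>))) \<Longrightarrow>
       lorentz_norm M p r u \<le> ennreal C * lorentz_norm N p r v"
proof (cases r)
  case (real q)
  then have q: "1 \<le> q" using assms(2) by (metis ennreal_1 ennreal_le_iff)
  have r: "r = ennreal q" by (rule real)
  define a where "a = q / p"
  have a: "0 < a" using q assms(1) by (simp add: a_def)
  define w where "w j = K powr a * 2 powr (\<theta> * real j * a) * (c * 2 ^ j) powr - q" for j :: nat
  have w_eq: "w j = K powr a * c powr - q * (2 powr (\<theta> * a - q)) ^ j" for j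
    using assms(5) by (simp add: w_def powr_mult powr_realpow[symmetric] powr_powr powr_add[symmetric] algebra_simps)
  have lt: "2 powr (\<theta> * a - q) < (1::real)"
  proof -
    have "\<theta> * a < p * a" using assms(3) a by simp
    also have "p * a = q" using assms(1) by (simp add: a_def)
    finally show ?thesis by (simp add: powr_less_one)
  qed
  have "summable w"
    unfolding w_eq[abs_def] using lt by (intro summable_mult summable_geometric) simp
  define W where "W = suminf w"
  have wpos: "0 < w j" for j using assms by (auto simp: w_def)
  have W: "0 < W" unfolding W_def by (intro suminf_pos \<open>summable w\<close> wpos)
  have sumw: "(\<Sum>j. ennreal (w j)) = ennreal W"
    unfolding W_def using \<open>summable w\<close> wpos by (intro suminf_ennreal2) (auto intro: less_imp_le)
  show thesis
  proof (rule that)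
    show "0 < W powr (1 / q)" using W by simp
  next
    fix u :: "'a \<Rightarrow> ennreal" and v :: "'b \<Rightarrow> ennreal"
    assume v[measurable]: "v \<in> borel_measurable N"
      and le: "\<And>\<alpha>. 0 < \<alpha> \<Longrightarrow> distribution M u \<alpha>
          \<le> ennreal K * (SUP j::nat. ennreal (2 powr (\<theta> * j)) * distribution N v (c * 2 ^ j * \<alpha>))"
    define D where "D \<alpha> = ennpowr (distribution N v \<alpha>) a" for \<alpha>
    have [measurable]: "D \<in> borel_measurable borel" unfolding D_def by measurable
    have pt: "ennpowr (distribution M u \<alpha>) a \<le>
        (\<Sum>j. ennreal (K powr a * 2 powr (\<theta> * real j * a)) * D (c * 2 ^ j * \<alpha>))" if "0 < \<alpha>" for \<alpha>
    proof -
      have "ennpowr (distribution M u \<alpha>) a \<le> ennpowr (SUP j. ennreal (K * 2 powr (\<theta> * real j)) * distribution N v (c * 2 ^ j * \<alpha>)) a"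
        using le[OF that] a assms(4)
        by (intro ennpowr_mono) (auto simp: SUP_mult_left_ennreal ennreal_mult' mult.assoc)
      also have "\<dots> \<le> (\<Sum>j. ennpowr (ennreal (K * 2 powr (\<theta> * real j)) * distribution N v (c * 2 ^ j * \<alpha>)) a)"
        by (rule ennpowr_SUP_le_suminf[OF a])
      also have "\<dots> = (\<Sum>j. ennreal (K powr a * 2 powr (\<theta> * real j * a)) * D (c * 2 ^ j * \<alpha>))"
        using assms(4) by (simp add: ennpowr_mult D_def powr_mult powr_powr)
      finally show ?thesis .
    qed
    let ?I = "\<integral>\<^sup>+ \<alpha>\<in>{0<..}. D \<alpha> * ennreal (\<alpha> powr (q - 1)) \<partial>lborel"
    have "(\<integral>\<^sup>+ \<alpha>\<in>{0<..}. ennpowr (distribution M u \<alpha>) a * ennreal (\<alpha> powr (q - 1)) \<partial>lborel)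
       \<le> (\<integral>\<^sup>+ \<alpha>. (\<Sum>j. ennreal (K powr a * 2 powr (\<theta> * real j * a)) *
             (D (c * 2 ^ j * \<alpha>) * ennreal (\<alpha> powr (q - 1)) * indicator {0<..} \<alpha>)) \<partial>lborel)"
    proof (rule nn_integral_mono)
      fix \<alpha> :: real
      show "ennpowr (distribution M u \<alpha>) a * ennreal (\<alpha> powr (q - 1)) * indicator {0<..} \<alpha>
        \<le> (\<Sum>j. ennreal (K powr a * 2 powr (\<theta> * real j * a)) *
             (D (c * 2 ^ j * \<alpha>) * ennreal (\<alpha> powr (q - 1)) * indicator {0<..} \<alpha>))"
      proof (cases "0 < \<alpha>")
        case True
        have "ennpowr (distribution M u \<alpha>) a * (ennreal (\<alpha> powr (q - 1)) * indicator {0<..} \<alpha>)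
          \<le> (\<Sum>j. ennreal (K powr a * 2 powr (\<theta> * real j * a)) * D (c * 2 ^ j * \<alpha>)) * (ennreal (\<alpha> powr (q - 1)) * indicator {0<..} \<alpha>)"
          using pt[OF True] by (intro mult_right_mono) auto
        then show ?thesis
          unfolding ennreal_suminf_multc[symmetric]
          by (simp add: mult.assoc del: ennreal_suminf_multc)
      qed simp
    qed
    also have "\<dots> = (\<Sum>j. \<integral>\<^sup>+ \<alpha>. ennreal (K powr a * 2 powr (\<theta> * real j * a)) *
             (D (c * 2 ^ j * \<alpha>) * ennreal (\<alpha> powr (q - 1)) * indicator {0<..} \<alpha>) \<partial>lborel)"
      by (rule nn_integral_suminf) measurable
    also have "\<dots> = (\<Sum>j. ennreal (w j) * ?I)"
    proof (intro suminf_cong)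
      fix j :: nat
      have "(\<integral>\<^sup>+ \<alpha>. ennreal (K powr a * 2 powr (\<theta> * real j * a)) *
             (D (c * 2 ^ j * \<alpha>) * ennreal (\<alpha> powr (q - 1)) * indicator {0<..} \<alpha>) \<partial>lborel)
         = ennreal (K powr a * 2 powr (\<theta> * real j * a)) * (\<integral>\<^sup>+ \<alpha>\<in>{0<..}. D (c * 2 ^ j * \<alpha>) * ennreal (\<alpha> powr (q - 1)) \<partial>lborel)"
        by (rule nn_integral_cmult) measurable
      also have "\<dots> = ennreal (w j) * ?I"
        using nn_integral_powr_scale[of D "c * 2 ^ j" q] assms(5)
        by (simp add: w_def ennreal_mult' mult.assoc)
      finally show "(\<integral>\<^sup>+ \<alpha>. ennreal (K powr a * 2 powr (\<theta> * real j * a)) *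
             (D (c * 2 ^ j * \<alpha>) * ennreal (\<alpha> powr (q - 1)) * indicator {0<..} \<alpha>) \<partial>lborel) = ennreal (w j) * ?I" .
    qed
    also have "\<dots> = ennreal W * ?I" by (simp add: sumw)
    finally have "(\<integral>\<^sup>+ \<alpha>\<in>{0<..}. ennpowr (distribution M u \<alpha>) a * ennreal (\<alpha> powr (q - 1)) \<partial>lborel) \<le> ennreal W * ?I" .
    then have "ennreal q * (\<integral>\<^sup>+ \<alpha>\<in>{0<..}. ennpowr (distribution M u \<alpha>) a * ennreal (\<alpha> powr (q - 1)) \<partial>lborel)
      \<le> ennreal W * (ennreal q * ?I)"
      unfolding mult.left_commute[of "ennreal W"] by (rule mult_left_mono) simp
    then have "ennpowr (ennreal q * (\<integral>\<^sup>+ \<alpha>\<in>{0<..}. ennpowr (distribution M u \<alpha>) a * ennreal (\<alpha> powr (q - 1)) \<partial>lborel)) (1 / q)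
      \<le> ennpowr (ennreal W * (ennreal q * ?I)) (1 / q)"
      using q by (intro ennpowr_mono) auto
    also have "\<dots> = ennreal (W powr (1 / q)) * ennpowr (ennreal q * ?I) (1 / q)"
      by (rule ennpowr_mult[OF W])
    finally show "lorentz_norm M p r u \<le> ennreal (W powr (1 / q)) * lorentz_norm N p r v"
      unfolding r lorentz_norm_ennreal[OF q] D_def a_def .
  qed
next
  case top
  define C where "C = K powr (1 / p) / c"
  have C: "0 < C" using assms by (simp add: C_def)
  show thesis
  proof (rule that[OF C])
    fix u :: "'a \<Rightarrow> ennreal" and v :: "'b \<Rightarrow> ennreal"
    assume v[measurable]: "v \<in> borel_measurable N"
      and le: "\<And>\<alpha>. 0 < \<alpha> \<Longrightarrow> distribution M u \<alpha>
          \<le> ennreal K * (SUP j::nat. ennreal (2 powr (\<theta> * j)) * distribution N v (c * 2 ^ j * \<alpha>))"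
    have bound: "ennreal \<alpha> * ennpowr (distribution M u \<alpha>) (1 / p) \<le> ennreal C * lorentz_norm N p \<infinity> v" (is "?l \<le> ennreal C * ?R")
      if "0 < \<alpha>" for \<alpha>
    proof -
      have "ennpowr (ennreal (2 powr (\<theta> * real j)) * distribution N v (c * 2 ^ j * \<alpha>)) (1 / p) \<le> ennreal (1 / (c * \<alpha>)) * ?R" for j
      proof -
        have "ennpowr (ennreal (2 powr (\<theta> * real j)) * distribution N v (c * 2 ^ j * \<alpha>)) (1 / p)
          = ennreal (2 powr (\<theta> / p * real j)) * ennpowr (distribution N v (c * 2 ^ j * \<alpha>)) (1 / p)"
          by (simp add: ennpowr_mult powr_powr)
        also have "\<dots> \<le> ennreal (2 powr (real j)) * ennpowr (distribution N v (c * 2 ^ j * \<alpha>)) (1 / p)"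
          using mult_right_mono[of "\<theta> / p" 1 "real j"] assms(1,3)
          by (intro mult_right_mono ennreal_leI powr_mono) auto
        also have "\<dots> = ennreal (1 / (c * \<alpha>)) * (ennreal (c * 2 ^ j * \<alpha>) * ennpowr (distribution N v (c * 2 ^ j * \<alpha>)) (1 / p))"
          using that assms(5) by (simp add: mult.assoc[symmetric] ennreal_mult'[symmetric] powr_realpow)
        also have "\<dots> \<le> ennreal (1 / (c * \<alpha>)) * ?R"
          unfolding lorentz_norm_top using that assms(5)
          by (intro mult_left_mono SUP_upper2[where i="c * 2 ^ j * \<alpha>"]) auto
        finally show ?thesis .
      qed
      note * = this
      have "(SUP j::nat. ennreal (2 powr (\<theta> * j)) * distribution N v (c * 2 ^ j * \<alpha>)) \<le> ennpowr (ennreal (1 / (c * \<alpha>)) * ?R) p"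
      proof (rule SUP_least)
        fix j :: nat
        show "ennreal (2 powr (\<theta> * j)) * distribution N v (c * 2 ^ j * \<alpha>) \<le> ennpowr (ennreal (1 / (c * \<alpha>)) * ?R) p"
          using ennpowr_mono[OF *[of j], of p] assms(1) by (simp add: ennpowr_ennpowr)
      qed
      then have "distribution M u \<alpha> \<le> ennreal K * ennpowr (ennreal (1 / (c * \<alpha>)) * ?R) p"
        by (intro order.trans[OF le[OF that]] mult_left_mono) auto
      then have "ennpowr (distribution M u \<alpha>) (1 / p) \<le> ennpowr (ennreal K * ennpowr (ennreal (1 / (c * \<alpha>)) * ?R) p) (1 / p)"
        using assms(1) by (intro ennpowr_mono) auto
      also have "\<dots> = ennreal (K powr (1 / p)) * (ennreal (1 / (c * \<alpha>)) * ?R)"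
        using assms(1,4) by (simp add: ennpowr_mult ennpowr_ennpowr)
      finally have "?l \<le> ennreal \<alpha> * (ennreal (K powr (1 / p)) * (ennreal (1 / (c * \<alpha>)) * ?R))"
        by (intro mult_left_mono) auto
      also have "\<dots> = ennreal C * ?R"
        using that assms(5) by (simp add: mult.assoc[symmetric] ennreal_mult'[symmetric] C_def)
      finally show ?thesis .
    qed
    have "lorentz_norm M p \<infinity> u \<le> ennreal C * lorentz_norm N p \<infinity> v"
      unfolding lorentz_norm_top[of M] by (rule SUP_least) (use bound in auto)
    then show "lorentz_norm M p r u \<le> ennreal C * lorentz_norm N p r v" by (simp add: top)
  qed
qed

text \<open>On all of \<open>(0, \<beta>]\<close> the distribution function is at least its value at
  \<beta>. The factor \<open>r\<close> in the norm turns the integral of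
  \<open>\<alpha> powr (r - 1)\<close> over this interval into exactly
  \<open>\<beta> powr r\<close>, so the constant is 1.\<close>

lemma lorentz_norm_Chebyshev:
  assumes [measurable]: "u \<in> borel_measurable M" and "1 \<le> p" "1 \<le> r" "0 < \<beta>"
  shows "ennreal \<beta> * ennpowr (distribution M u \<beta>) (1 / p) \<le> lorentz_norm M p r u"
proof (cases r)
  case (real q)
  then have q: "1 \<le> q" using assms(3) by (metis ennreal_1 ennreal_le_iff)
  have r: "r = ennreal q" by (rule real)
  have powr_int: "ennreal q * (\<integral>\<^sup>+ \<alpha>\<in>{0<..\<beta>}. ennreal (\<alpha> powr (q - 1)) \<partial>lborel) = ennreal (\<beta> powr q)"
  proof -
    have "((\<lambda>\<alpha>. \<alpha> powr (q - 1)) has_integral (\<beta> powr q / q)) {0..\<beta>}"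
      using has_integral_powr_from_0[of "q - 1" \<beta>] q assms(4) by simp
    then have "(\<integral>\<^sup>+ \<alpha>. ennreal (\<alpha> powr (q - 1)) * indicator {0..\<beta>} \<alpha> \<partial>lborel) = ennreal (\<beta> powr q / q)"
      by (intro nn_integral_has_integral_lebesgue') auto
    also have "(\<integral>\<^sup>+ \<alpha>. ennreal (\<alpha> powr (q - 1)) * indicator {0..\<beta>} \<alpha> \<partial>lborel)
        = (\<integral>\<^sup>+ \<alpha>\<in>{0<..\<beta>}. ennreal (\<alpha> powr (q - 1)) \<partial>lborel)"
      by (intro nn_integral_cong) (auto simp: indicator_def)
    finally show ?thesis using q by (simp add: ennreal_mult'[symmetric])
  qed
  let ?D = "ennpowr (distribution M u \<beta>) (q / p)"
  have "ennreal (\<beta> powr q) * ?D = ennreal q * (\<integral>\<^sup>+ \<alpha>\<in>{0<..\<beta>}. ?D * ennreal (\<alpha> powr (q - 1)) \<partial>lborel)"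
    unfolding powr_int[symmetric] by (simp add: mult.assoc nn_integral_cmult) (simp add: mult_ac)
  also have "\<dots> \<le> ennreal q * (\<integral>\<^sup>+ \<alpha>\<in>{0<..}. ennpowr (distribution M u \<alpha>) (q / p) * ennreal (\<alpha> powr (q - 1)) \<partial>lborel)"
    using q assms(2)
    by (intro mult_left_mono nn_integral_mono)
       (auto simp: indicator_def intro!: mult_right_mono ennpowr_mono distribution_antimono)
  finally have "ennpowr (ennreal (\<beta> powr q) * ?D) (1 / q) \<le> lorentz_norm M p r u"
    unfolding r lorentz_norm_ennreal[OF q] using q by (intro ennpowr_mono) auto
  then show ?thesis using q assms(4) by (simp add: ennpowr_mult ennpowr_ennpowr powr_powr)
next
  case top
  then show ?thesis using assms(4) by (auto simp: lorentz_norm_def intro!: SUP_upper)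
qed

text \<open>The layer cake formula: Fubini applied to the region below the graph of
  \<open>u\<close>.\<close>

lemma nn_integral_eq_nn_integral_distribution:
  assumes "sigma_finite_measure M" and [measurable]: "u \<in> borel_measurable M"
  shows "(\<integral>\<^sup>+ x. u x \<partial>M) = (\<integral>\<^sup>+ \<alpha>\<in>{0<..}. distribution M u \<alpha> \<partial>lborel)"
proof -
  interpret sigma_finite_measure M by fact
  interpret pair_sigma_finite lborel M ..
  have "(\<integral>\<^sup>+ \<alpha>\<in>{0<..}. distribution M u \<alpha> \<partial>lborel) =
     (\<integral>\<^sup>+ \<alpha>. (\<integral>\<^sup>+ x. indicator {x \<in> space M. u x > ennreal \<alpha>} x * indicator {0<..} \<alpha> \<partial>M) \<partial>lborel)"
    by (simp add: nn_integral_multc)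
  also have "\<dots> = (\<integral>\<^sup>+ \<alpha>. (\<integral>\<^sup>+ x. (if 0 < \<alpha> \<and> ennreal \<alpha> < u x then 1 else 0) \<partial>M) \<partial>lborel)"
    by (intro nn_integral_cong) (auto simp: indicator_def)
  also have "\<dots> = (\<integral>\<^sup>+ x. (\<integral>\<^sup>+ \<alpha>. (if 0 < \<alpha> \<and> ennreal \<alpha> < u x then 1 else 0) \<partial>lborel) \<partial>M)"
    by (rule Fubini'[symmetric]) measurable
  also have "\<dots> = (\<integral>\<^sup>+ x. u x \<partial>M)"
  proof (intro nn_integral_cong)
    fix x
    show "(\<integral>\<^sup>+ \<alpha>. (if 0 < \<alpha> \<and> ennreal \<alpha> < u x then 1 else 0) \<partial>lborel) = u x"
    proof (cases "u x")
      case (real t)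
      have "(\<integral>\<^sup>+ \<alpha>. (if 0 < \<alpha> \<and> ennreal \<alpha> < u x then 1 else 0) \<partial>lborel) = (\<integral>\<^sup>+ \<alpha>. indicator {0<..<t} \<alpha> \<partial>lborel)"
        using real by (intro nn_integral_cong) (auto simp: indicator_def ennreal_less_iff)
      then show ?thesis using real by simp
    next
      case top
      have "(\<integral>\<^sup>+ \<alpha>. (if 0 < \<alpha> \<and> ennreal \<alpha> < u x then 1 else 0) \<partial>lborel) = (\<integral>\<^sup>+ \<alpha>. indicator {0::real<..} \<alpha> \<partial>lborel)"
        using top by (intro nn_integral_cong) (auto simp: indicator_def)
      moreover have "emeasure lborel {0::real<..} = top"
      proof -
        have "of_nat n \<le> emeasure lborel {0::real<..}" for n :: nat
        proof -
          have "{0<..<real n} \<subseteq> {0<..}" by auto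
          from emeasure_mono[OF this, of lborel] show ?thesis
            by (simp add: ennreal_of_nat_eq_real_of_nat)
        qed
        then show ?thesis
          by (metis SUP_least ennreal_SUP_of_nat_eq_top top.extremum_uniqueI)
      qed
      ultimately show ?thesis using top by simp
    qed
  qed
  finally show ?thesis by simp
qed

lemma lorentz_norm_one_one:
  assumes "sigma_finite_measure M" and "u \<in> borel_measurable M"
  shows "lorentz_norm M 1 1 u = (\<integral>\<^sup>+ x. u x \<partial>M)"
proof -
  have "lorentz_norm M 1 (ennreal 1) u = (\<integral>\<^sup>+ \<alpha>\<in>{0<..}. distribution M u \<alpha> \<partial>lborel)"
    unfolding lorentz_norm_ennreal[OF order.refl]
    by (auto intro!: nn_integral_cong simp: indicator_def)
  then show ?thesis using assms by (simp add: nn_integral_eq_nn_integral_distribution)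
qed

subsection \<open>Maximal separated sets\<close>

lemma ennreal_divide_mono:
  fixes a b c d :: ennreal
  assumes "a \<le> c" "d \<le> b"
  shows "a / b \<le> c / d"
proof -
  have "inverse b \<le> inverse d"
    using assms(2) including ennreal.lifting by transfer (rule ereal_inverse_antimono)
  then show ?thesis using assms(1) unfolding divide_ennreal_def by (intro mult_mono) auto
qed

lemma ball_in_sets_borel [measurable]: "ball x r \<in> sets borel"
  by simp

lemma set_nn_integral_UN_incseq:
  assumes "incseq B" "\<And>n::nat. B n \<in> sets M" and [measurable]: "g \<in> borel_measurable M"
  shows "(\<integral>\<^sup>+ x\<in>(\<Union>n. B n). g x \<partial>M) = (SUP n. \<integral>\<^sup>+ x\<in>B n. g x \<partial>M)"
  using SUP_emeasure_incseq[of B "density M g"] assms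
  by (auto simp: emeasure_density image_subset_iff)

text \<open>The form in which local doubling and the ball size condition enter the transfer. Upper
  bounds at every radius are included because covering arguments enlarge balls by multiples of the
  distortion constant.\<close>

definition uniformly_sized :: "'a::metric_space measure \<Rightarrow> bool" where
  "uniformly_sized \<mu> \<longleftrightarrow> sets \<mu> = sets borel \<and>
     (\<exists>c>0. \<forall>x. ennreal c \<le> emeasure \<mu> (ball x 1)) \<and>
     (\<forall>\<rho>. \<exists>S>0. \<forall>x. emeasure \<mu> (ball x \<rho>) \<le> ennreal S)"

lemma uniformly_sized_lower:
  assumes "uniformly_sized \<mu>"
  obtains c :: real where "0 < c" "\<And>x. ennreal c \<le> emeasure \<mu> (ball x 1)"
  using assms unfolding uniformly_sized_def by blast

lemma uniformly_sized_upper: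
  assumes "uniformly_sized \<mu>"
  obtains S :: real where "0 < S" "\<And>x. emeasure \<mu> (ball x \<rho>) \<le> ennreal S"
  using assms unfolding uniformly_sized_def by blast

lemma uniformly_sized_sets: "uniformly_sized \<mu> \<Longrightarrow> sets \<mu> = sets borel"
  by (simp add: uniformly_sized_def)

lemma uniformly_sized_finite:
  "uniformly_sized \<mu> \<Longrightarrow> emeasure \<mu> (ball x \<rho>) < \<infinity>"
  by (metis ennreal_less_top infinity_ennreal_def order.strict_trans1 uniformly_sized_upper)

lemma UN_ball_of_nat: "(\<Union>n::nat. ball x (real n)) = UNIV"
  using reals_Archimedean2 by auto

lemma incseq_ball_of_nat: "incseq (\<lambda>n::nat. ball x (real n))"
  by (intro incseq_SucI subset_ball) simp

lemma uniformly_sized_sigma_finite: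
  fixes \<mu> :: "'a::metric_space measure"
  assumes "uniformly_sized \<mu>"
  shows "sigma_finite_measure \<mu>"
proof
  have [simp]: "space \<mu> = UNIV" using sets_eq_imp_space_eq[OF uniformly_sized_sets[OF assms]] by simp
  let ?A = "range (\<lambda>n::nat. ball (undefined::'a) (real n))"
  show "\<exists>A. countable A \<and> A \<subseteq> sets \<mu> \<and> \<Union>A = space \<mu> \<and> (\<forall>a\<in>A. emeasure \<mu> a \<noteq> \<infinity>)"
    using uniformly_sized_finite[OF assms] UN_ball_of_nat[of undefined]
    by (intro exI[of _ ?A]) (auto simp: uniformly_sized_sets[OF assms] less_top)
qed

text \<open>Doubling is iterated along radii \<open>2 ^ k\<close>, starting from unit balls. Its
  constant may change with \<open>k\<close>, so the bound grows without control in the radius, but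
  it stays uniform in the centre.\<close>

lemma uniformly_sizedI:
  fixes \<mu> :: "'a::metric_space measure"
  assumes "metric_measure_space \<mu>" "locally_doubling \<mu>" "uniform_ball_size \<mu>"
  shows "uniformly_sized \<mu>"
  unfolding uniformly_sized_def
proof (intro conjI allI)
  show sets: "sets \<mu> = sets borel" using assms(1) by (simp add: metric_measure_space_def)
  have "0 < (INF x. emeasure \<mu> (ball x 1))" using assms(3) by (simp add: uniform_ball_size_def)
  then obtain c where "0 < c" "ennreal c < (INF x. emeasure \<mu> (ball x 1))"
    by (metis ennreal_0 ennreal_less_zero_iff ennreal_rat_dense linorder_not_le ennreal_eq_0_iff)
  then show "\<exists>c>0. \<forall>x. ennreal c \<le> emeasure \<mu> (ball x 1)"
    by (intro exI[of _ c]) (auto intro!: less_imp_le[OF less_INF_D])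
  fix \<rho> :: real
  have pow: "\<exists>S>0. \<forall>x. emeasure \<mu> (ball x (2 ^ k)) \<le> ennreal S" for k :: nat
  proof (induction k)
    case 0
    have "(SUP x. emeasure \<mu> (ball x 1)) < top" using assms(3) by (simp add: uniform_ball_size_def)
    then obtain S where "(SUP x. emeasure \<mu> (ball x 1)) = ennreal S" "0 \<le> S"
      by (cases "SUP x. emeasure \<mu> (ball x 1)") auto
    then have "emeasure \<mu> (ball x 1) \<le> ennreal (S + 1)" for x
      by (metis SUP_upper UNIV_I add.commute ennreal_leI le_add_same_cancel2 order_trans zero_le_one)
    then show ?case using \<open>0 \<le> S\<close> by (intro exI[of _ "S + 1"]) auto
  next
    case (Suc k)
    then obtain S where S: "0 < S" "\<And>x. emeasure \<mu> (ball x (2 ^ k)) \<le> ennreal S" by blast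
    obtain D :: real where D: "\<And>x r. 0 < r \<Longrightarrow> r \<le> 2 ^ k \<Longrightarrow>
        emeasure \<mu> (ball x (2 * r)) \<le> ennreal D * emeasure \<mu> (ball x r)"
      using assms(2) unfolding locally_doubling_def by (meson zero_less_numeral zero_less_power)
    have "emeasure \<mu> (ball x (2 ^ Suc k)) \<le> ennreal ((\<bar>D\<bar> + 1) * S)" for x
    proof -
      have "emeasure \<mu> (ball x (2 ^ Suc k)) \<le> ennreal D * emeasure \<mu> (ball x (2 ^ k))"
        using D[of "2 ^ k" x] by simp
      also have "\<dots> \<le> ennreal (\<bar>D\<bar> + 1) * ennreal S"
        by (intro mult_mono S ennreal_leI) auto
      finally show ?thesis by (simp add: ennreal_mult' del: ennreal_plus)
    qed
    then show ?case using S(1) by (intro exI[of _ "(\<bar>D\<bar> + 1) * S"]) auto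
  qed
  obtain k :: nat where "\<rho> \<le> 2 ^ k"
    by (meson less_imp_le one_less_numeral_iff real_arch_pow semiring_norm(76))
  then have "emeasure \<mu> (ball x \<rho>) \<le> emeasure \<mu> (ball x (2 ^ k))" for x
    by (intro emeasure_mono subset_ball) (simp_all add: sets)
  then show "\<exists>S>0. \<forall>x. emeasure \<mu> (ball x \<rho>) \<le> ennreal S"
    using pow[of k] order_trans by blast
qed

text \<open>The distance 2 makes the unit balls about the points disjoint.\<close>

definition separated :: "'a::metric_space set \<Rightarrow> bool" where
  "separated I \<longleftrightarrow> pairwise (\<lambda>x y. 2 \<le> dist x y) I"

text \<open>Packing: disjoint unit balls, each of measure at least \<open>c\<close>, all fit into
  the ball of radius \<open>\<rho> + 1\<close>, whose measure is at most \<open>S\<close>.\<close>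

lemma separated_card_le:
  fixes \<mu> :: "'a::metric_space measure"
  assumes "uniformly_sized \<mu>"
  obtains n :: nat where "\<And>x (I :: 'a set). finite I \<Longrightarrow> separated I \<Longrightarrow> I \<subseteq> ball x \<rho> \<Longrightarrow> card I \<le> n"
proof -
  obtain c where c: "0 < c" "\<And>x. ennreal c \<le> emeasure \<mu> (ball x 1)"
    using uniformly_sized_lower[OF assms] by blast
  obtain S where S: "0 < S" "\<And>x. emeasure \<mu> (ball x (\<rho> + 1)) \<le> ennreal S"
    using uniformly_sized_upper[OF assms] by blast
  note sets = uniformly_sized_sets[OF assms]
  have "card I \<le> nat \<lceil>S / c\<rceil>" if I: "finite I" "separated I" "I \<subseteq> ball x \<rho>" for x and I :: "'a set"
  proof -
    have disj: "disjoint_family_on (\<lambda>a. ball a 1) I"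
      unfolding disjoint_family_on_def
    proof (intro ballI impI)
      fix a b assume "a \<in> I" "b \<in> I" "a \<noteq> b"
      then have "2 \<le> dist a b" using I(2) by (auto simp: separated_def pairwise_def)
      then show "ball a 1 \<inter> ball b 1 = {}"
        by (auto simp: ball_def) (smt (verit) dist_triangle2 dist_commute)
    qed
    have "ennreal (real (card I) * c) = (\<Sum>a\<in>I. ennreal c)"
      using c(1) by (simp add: ennreal_mult' ennreal_of_nat_eq_real_of_nat)
    also have "\<dots> \<le> (\<Sum>a\<in>I. emeasure \<mu> (ball a 1))" by (intro sum_mono c)
    also have "\<dots> = emeasure \<mu> (\<Union>a\<in>I. ball a 1)"
      using I(1) disj by (intro sum_emeasure) (auto simp: sets)
    also have "\<dots> \<le> emeasure \<mu> (ball x (\<rho> + 1))"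
    proof (intro emeasure_mono)
      show "(\<Union>a\<in>I. ball a 1) \<subseteq> ball x (\<rho> + 1)"
        using I(3) by (auto simp: subset_iff) (smt (verit) dist_triangle)
    qed (simp add: sets)
    also have "\<dots> \<le> ennreal S" by (rule S)
    finally have "real (card I) * c \<le> S" using S(1) by (simp add: ennreal_le_iff)
    then have "real (card I) \<le> S / c" using c(1) by (simp add: field_simps)
    then show ?thesis by linarith
  qed
  then show thesis by (rule that)
qed

text \<open>The packing bound allows a separated subset of greatest cardinality to be chosen; a
  point of \<open>A\<close> missed by its 2-balls could be added to it.\<close>

lemma finite_net:
  fixes \<mu> :: "'a::metric_space measure" and A :: "'a set"
  assumes "uniformly_sized \<mu>" "A \<subseteq> ball x \<rho>"
  obtains I where "finite I" "I \<subseteq> A" "separated I" "A \<subseteq> (\<Union>a\<in>I. ball a 2)"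
proof -
  obtain n where n: "\<And>x (I :: 'a set). finite I \<Longrightarrow> separated I \<Longrightarrow> I \<subseteq> ball x \<rho> \<Longrightarrow> card I \<le> n"
    using separated_card_le[OF assms(1)] by blast
  let ?P = "\<lambda>I. finite I \<and> I \<subseteq> A \<and> separated I"
  have "\<forall>I. ?P I \<longrightarrow> card I < Suc n"
  proof (intro allI impI)
    fix I assume "?P I"
    then have "card I \<le> n" using assms(2) by (intro n[of I x]) auto
    then show "card I < Suc n" by simp
  qed
  moreover have "?P {}" by (simp add: separated_def)
  ultimately obtain I where I: "?P I" "\<And>J. ?P J \<Longrightarrow> card J \<le> card I"
    using ex_has_greatest_nat[of ?P "{}" card "Suc n"] by blast
  have "A \<subseteq> (\<Union>a\<in>I. ball a 2)"
  proof (rule ccontr)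
    assume "\<not> ?thesis"
    then obtain b where b: "b \<in> A" "\<And>a. a \<in> I \<Longrightarrow> 2 \<le> dist a b" by force
    then have "b \<notin> I" by force
    have "?P (insert b I)"
      using I(1) b by (auto simp: separated_def pairwise_insert dist_commute)
    from I(2)[OF this] show False using \<open>b \<notin> I\<close> I(1) by simp
  qed
  then show thesis using I(1) that by blast
qed

text \<open>Sum the local hypothesis over a maximal 2-separated subset of (a bounded part of) \<open>A\<close>; the
  images of its points can only crowd together in \<open>R\<close>-balls boundedly often.\<close>

lemma net_comparison:
  fixes \<mu> :: "'a::metric_space measure" and \<nu> :: "'b::metric_space measure" and \<phi> :: "'a \<Rightarrow> 'b"
  assumes \<mu>: "uniformly_sized \<mu>" and \<nu>: "sets \<nu> = sets borel"
    and expand: "\<And>x y. dist x y \<le> dist (\<phi> x) (\<phi> y) + \<beta>"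
  obtains K :: real where "0 < K"
    "\<And>g h A. g \<in> borel_measurable borel \<Longrightarrow> h \<in> borel_measurable borel \<Longrightarrow> A \<in> sets borel \<Longrightarrow>
      (\<And>a. a \<in> A \<Longrightarrow> (\<integral>\<^sup>+ x\<in>ball a 2. g x \<partial>\<mu>) \<le> (\<integral>\<^sup>+ y\<in>ball (\<phi> a) R. h y \<partial>\<nu>)) \<Longrightarrow>
      (\<integral>\<^sup>+ x\<in>A. g x \<partial>\<mu>) \<le> ennreal K * (\<integral>\<^sup>+ y. h y \<partial>\<nu>)"
proof -
  \<comment> \<open>Two points whose images lie within \<open>R\<close> of a common point are less
    than \<open>2 * R + \<beta>\<close> apart, by \<open>expand\<close>. Hence \<open>n\<close>
    bounds the overlap of the \<open>R\<close>-balls about the images of a separated set.\<close>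
  obtain n where n: "\<And>x (I :: 'a set). finite I \<Longrightarrow> separated I \<Longrightarrow> I \<subseteq> ball x (2 * R + \<beta>) \<Longrightarrow> card I \<le> n"
    using separated_card_le[OF \<mu>] by blast
  note sets[measurable_cong] = uniformly_sized_sets[OF \<mu>] \<nu>
  show thesis
  proof (rule that)
    show "0 < real (Suc n)" by simp
  next
    fix g :: "'a \<Rightarrow> ennreal" and h :: "'b \<Rightarrow> ennreal" and A :: "'a set"
    assume [measurable]: "g \<in> borel_measurable borel" "h \<in> borel_measurable borel" "A \<in> sets borel"
      and loc: "\<And>a. a \<in> A \<Longrightarrow> (\<integral>\<^sup>+ x\<in>ball a 2. g x \<partial>\<mu>) \<le> (\<integral>\<^sup>+ y\<in>ball (\<phi> a) R. h y \<partial>\<nu>)"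
    have bdd: "(\<integral>\<^sup>+ x\<in>A \<inter> ball z \<rho>. g x \<partial>\<mu>) \<le> ennreal (real (Suc n)) * (\<integral>\<^sup>+ y. h y \<partial>\<nu>)" for z \<rho>
    proof -
      obtain I where I: "finite I" "I \<subseteq> A \<inter> ball z \<rho>" "separated I" "A \<inter> ball z \<rho> \<subseteq> (\<Union>a\<in>I. ball a 2)"
        using finite_net[OF \<mu>, of "A \<inter> ball z \<rho>" z \<rho>] by blast
      have overlap: "card {a \<in> I. y \<in> ball (\<phi> a) R} \<le> n" for y
      proof (cases "{a \<in> I. y \<in> ball (\<phi> a) R} = {}")
        case False
        then obtain b where b: "b \<in> I" "dist (\<phi> b) y < R" by auto
        have "{a \<in> I. y \<in> ball (\<phi> a) R} \<subseteq> ball b (2 * R + \<beta>)"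
        proof clarsimp
          fix a assume "dist (\<phi> a) y < R"
          with b(2) have "dist (\<phi> b) (\<phi> a) < 2 * R" by (smt (verit) dist_triangle2)
          with expand[of b a] show "dist b a < 2 * R + \<beta>" by simp
        qed
        moreover have "separated {a \<in> I. y \<in> ball (\<phi> a) R}"
          using I(3) by (auto simp: separated_def pairwise_def)
        ultimately show ?thesis using I(1) n by simp
      next
        case True
        then show ?thesis by (simp only: card.empty)
      qed
      have "(\<integral>\<^sup>+ x\<in>A \<inter> ball z \<rho>. g x \<partial>\<mu>) \<le> (\<integral>\<^sup>+ x. (\<Sum>a\<in>I. g x * indicator (ball a 2) x) \<partial>\<mu>)"
      proof (intro nn_integral_mono)
        fix x
        show "g x * indicator (A \<inter> ball z \<rho>) x \<le> (\<Sum>a\<in>I. g x * indicator (ball a 2) x)"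
        proof (cases "x \<in> A \<inter> ball z \<rho>")
          case True
          then obtain a where a: "a \<in> I" "x \<in> ball a 2" using I(4) by blast
          have "g x * indicator (ball a 2) x \<le> (\<Sum>a\<in>I. g x * indicator (ball a 2) x)"
            using I(1) a by (intro member_le_sum) auto
          then show ?thesis using True a by simp
        qed simp
      qed
      also have "\<dots> = (\<Sum>a\<in>I. \<integral>\<^sup>+ x\<in>ball a 2. g x \<partial>\<mu>)" by (rule nn_integral_sum) measurable
      also have "\<dots> \<le> (\<Sum>a\<in>I. \<integral>\<^sup>+ y\<in>ball (\<phi> a) R. h y \<partial>\<nu>)" using I(2) by (intro sum_mono loc) auto
      also have "\<dots> = (\<integral>\<^sup>+ y. (\<Sum>a\<in>I. h y * indicator (ball (\<phi> a) R) y) \<partial>\<nu>)"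
        by (rule nn_integral_sum[symmetric]) measurable
      also have "\<dots> \<le> (\<integral>\<^sup>+ y. ennreal (real (Suc n)) * h y \<partial>\<nu>)"
      proof (intro nn_integral_mono)
        fix y
        have "(\<Sum>a\<in>I. h y * indicator (ball (\<phi> a) R) y) = h y * of_nat (card {a \<in> I. y \<in> ball (\<phi> a) R})"
          using I(1) by (simp add: sum_distrib_left[symmetric] indicator_def sum.If_cases Int_def
            del: mem_ball)
        also have "\<dots> \<le> h y * ennreal (real (Suc n))"
          using overlap[of y] by (intro mult_left_mono) (auto simp: ennreal_of_nat_eq_real_of_nat simp del: mem_ball ennreal_plus of_nat_Suc)
        finally show "(\<Sum>a\<in>I. h y * indicator (ball (\<phi> a) R) y) \<le> ennreal (real (Suc n)) * h y"
          by (simp add: mult.commute)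
      qed
      also have "\<dots> = ennreal (real (Suc n)) * (\<integral>\<^sup>+ y. h y \<partial>\<nu>)" by (rule nn_integral_cmult) measurable
      finally show ?thesis .
    qed
    \<comment> \<open>Nets were found only in bounded sets, but the bound depends neither on the
      centre nor on the radius, so monotone convergence removes the truncation.\<close>
    have "A = (\<Union>k::nat. A \<inter> ball undefined (real k))" using UN_ball_of_nat by blast
    then have "(\<integral>\<^sup>+ x\<in>A. g x \<partial>\<mu>) = (SUP k::nat. \<integral>\<^sup>+ x\<in>A \<inter> ball undefined (real k). g x \<partial>\<mu>)"
      using set_nn_integral_UN_incseq[of "\<lambda>k::nat. A \<inter> ball undefined (real k)" \<mu> g]
        incseq_ball_of_nat[of undefined] by (simp add: incseq_def) blast
    also have "\<dots> \<le> ennreal (real (Suc n)) * (\<integral>\<^sup>+ y. h y \<partial>\<nu>)" by (intro SUP_least bdd)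
    finally show "(\<integral>\<^sup>+ x\<in>A. g x \<partial>\<mu>) \<le> ennreal (real (Suc n)) * (\<integral>\<^sup>+ y. h y \<partial>\<nu>)" .
  qed
qed

subsection \<open>Measurability of the maximal functions\<close>

text \<open>Inner regularity of balls: it makes both numerator and denominator of \<^const>\<open>ball_average\<close>
  lower semicontinuous in the centre, and lets the supremum over radii run over rationals.\<close>

lemma ball_integral_inner:
  fixes \<mu> :: "'a::metric_space measure"
  assumes sets: "sets \<mu> = sets borel" and [measurable]: "h \<in> borel_measurable borel"
    and "t < (\<integral>\<^sup>+ y\<in>ball x r. h y \<partial>\<mu>)"
  obtains \<rho> where "\<rho> < r" "t < (\<integral>\<^sup>+ y\<in>ball x \<rho>. h y \<partial>\<mu>)"
proof -
  note sets[measurable_cong]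
  define B where "B n = ball x (r - 1 / real (Suc n))" for n
  have "incseq B" unfolding B_def
    by (intro incseq_SucI subset_ball) (simp add: field_simps)
  have "ball x r = (\<Union>n. B n)"
  proof (intro set_eqI iffI)
    fix y assume "y \<in> ball x r"
    then obtain n where "1 / real (Suc n) < r - dist x y"
      using nat_approx_posE[of "r - dist x y"] by auto
    then have "y \<in> B n" by (simp add: B_def)
    then show "y \<in> (\<Union>n. B n)" by blast
  qed (auto simp: B_def intro: less_le_trans)
  then have "(\<integral>\<^sup>+ y\<in>ball x r. h y \<partial>\<mu>) = (SUP n. \<integral>\<^sup>+ y\<in>B n. h y \<partial>\<mu>)"
    using set_nn_integral_UN_incseq[OF \<open>incseq B\<close>, of \<mu> h] by (simp add: B_def sets)
  then obtain n where "t < (\<integral>\<^sup>+ y\<in>B n. h y \<partial>\<mu>)" using assms(3) by (auto simp: less_SUP_iff)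
  then show thesis by (intro that[of "r - 1 / real (Suc n)"]) (auto simp: B_def)
qed

lemma measurable_ball_integral:
  fixes \<mu> :: "'a::metric_space measure"
  assumes sets: "sets \<mu> = sets borel" and h[measurable]: "h \<in> borel_measurable borel"
  shows "(\<lambda>x. \<integral>\<^sup>+ y\<in>ball x r. h y \<partial>\<mu>) \<in> borel_measurable borel"
proof (rule borel_measurableI_greater)
  fix t
  have "open {x. t < (\<integral>\<^sup>+ y\<in>ball x r. h y \<partial>\<mu>)}"
    unfolding open_contains_ball
  proof clarsimp
    fix x assume "t < (\<integral>\<^sup>+ y\<in>ball x r. h y \<partial>\<mu>)"
    then obtain \<rho> where \<rho>: "\<rho> < r" "t < (\<integral>\<^sup>+ y\<in>ball x \<rho>. h y \<partial>\<mu>)"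
      by (rule ball_integral_inner[OF sets h])
    have "t < (\<integral>\<^sup>+ y\<in>ball z r. h y \<partial>\<mu>)" if "z \<in> ball x (r - \<rho>)" for z
    proof -
      have "ball x \<rho> \<subseteq> ball z r"
        using that by (auto simp: subset_iff) (smt (verit) dist_triangle3)
      then have "(\<integral>\<^sup>+ y\<in>ball x \<rho>. h y \<partial>\<mu>) \<le> (\<integral>\<^sup>+ y\<in>ball z r. h y \<partial>\<mu>)"
        by (intro nn_integral_mono mult_left_mono) (auto simp: indicator_def)
      with \<rho>(2) show ?thesis by simp
    qed
    then show "\<exists>e>0. ball x e \<subseteq> {x. t < (\<integral>\<^sup>+ y\<in>ball x r. h y \<partial>\<mu>)}"
      using \<rho>(1) by (intro exI[of _ "r - \<rho>"]) auto
  qed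
  then show "{x \<in> space borel. t < (\<integral>\<^sup>+ y\<in>ball x r. h y \<partial>\<mu>)} \<in> sets borel" by simp
qed

lemma measurable_centred_maximal:
  fixes \<mu> :: "'a::metric_space measure"
  assumes sets: "sets \<mu> = sets borel" and f[measurable]: "f \<in> borel_measurable borel"
  shows "centred_maximal \<mu> f \<in> borel_measurable borel"
proof -
  have eq: "centred_maximal \<mu> f x = (SUP q\<in>{1<..} \<inter> \<rat>. ball_average \<mu> f x q)" for x
  proof (rule antisym)
    show "centred_maximal \<mu> f x \<le> (SUP q\<in>{1<..} \<inter> \<rat>. ball_average \<mu> f x q)"
      unfolding centred_maximal_def
    proof (rule SUP_least)
      fix r :: real assume "r \<in> {1<..}"
      let ?I = "\<lambda>r. \<integral>\<^sup>+ y\<in>ball x r. ennreal (norm (f y)) \<partial>\<mu>"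
      \<comment> \<open>The rational radii are taken below \<open>r\<close>: the integral is
        exhausted from inside, and passing to a smaller ball only decreases the denominator of the
        average.\<close>
      have "?I r \<le> (SUP q\<in>{1<..<r} \<inter> \<rat>. ?I q)"
      proof (rule dense_le)
        fix t assume "t < ?I r"
        then obtain \<rho> where \<rho>: "\<rho> < r" "t < ?I \<rho>"
          by (rule ball_integral_inner[OF sets, rotated]) measurable
        obtain q where q: "q \<in> \<rat>" "max 1 \<rho> < q" "q < r"
          using Rats_dense_in_real[of "max 1 \<rho>" r] \<rho>(1) \<open>r \<in> {1<..}\<close> by auto
        have "?I \<rho> \<le> ?I q"
          using q by (intro nn_integral_mono mult_left_mono) (auto simp: indicator_def)
        then show "t \<le> (SUP q\<in>{1<..<r} \<inter> \<rat>. ?I q)"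
          using q \<rho>(2) by (intro SUP_upper2[of q]) auto
      qed
      then have "ball_average \<mu> f x r \<le> (SUP q\<in>{1<..<r} \<inter> \<rat>. ?I q / emeasure \<mu> (ball x r))"
        unfolding ball_average_def SUP_divide_ennreal[symmetric] by (rule divide_right_mono_ennreal)
      also have "\<dots> \<le> (SUP q\<in>{1<..} \<inter> \<rat>. ball_average \<mu> f x q)"
      proof (rule SUP_mono)
        fix q assume "q \<in> {1<..<r} \<inter> \<rat>"
        then show "\<exists>m\<in>{1<..} \<inter> \<rat>. ?I q / emeasure \<mu> (ball x r) \<le> ball_average \<mu> f x m"
          unfolding ball_average_def
          by (intro bexI[of _ q] ennreal_divide_mono emeasure_mono subset_ball)
             (auto simp: sets)
      qed
      finally show "ball_average \<mu> f x r \<le> (SUP q\<in>{1<..} \<inter> \<rat>. ball_average \<mu> f x q)" .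
    qed
    show "(SUP q\<in>{1<..} \<inter> \<rat>. ball_average \<mu> f x q) \<le> centred_maximal \<mu> f x"
      unfolding centred_maximal_def by (intro SUP_subset_mono) auto
  qed
  have "(\<lambda>x. ball_average \<mu> f x q) \<in> borel_measurable borel" for q
  proof -
    have "(\<lambda>x. emeasure \<mu> (ball x q)) \<in> borel_measurable borel"
      using measurable_ball_integral[OF sets, of "\<lambda>_. 1" q] by (simp add: sets)
    then show ?thesis
      unfolding ball_average_def
      by (intro borel_measurable_divide_ennreal measurable_ball_integral sets) measurable
  qed
  moreover have "countable ({1<..} \<inter> \<rat> :: real set)" by (simp add: countable_rat)
  ultimately show ?thesis
    unfolding eq[abs_def] by (intro borel_measurable_SUP) auto
qed

lemma measurable_uncentred_maximal:
  fixes \<mu> :: "'a::metric_space measure"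
  shows "uncentred_maximal \<mu> f \<in> borel_measurable borel"
proof (rule borel_measurableI_greater)
  fix t
  have "{x. t < uncentred_maximal \<mu> f x} = (\<Union>(c, r)\<in>{(c, r). r > 1 \<and> t < ball_average \<mu> f c r}. ball c r)"
    by (auto simp: uncentred_maximal_def less_SUP_iff) blast
  then have "open {x. t < uncentred_maximal \<mu> f x}" by auto
  then show "{x \<in> space borel. t < uncentred_maximal \<mu> f x} \<in> sets borel" by simp
qed

subsection \<open>Transfer along a rough isometry\<close>

text \<open>Walk from \<open>x\<close> towards \<open>y\<close> for length \<rho>. This pulls a
  point of an enlarged ball back into the ball at the cost of a displacement \<open>d\<close> that
  does not depend on \<rho>.\<close>

lemma geodesic_space_move:
  assumes "geodesic_space TYPE('a::metric_space)" "0 \<le> \<rho>" "0 \<le> d" "dist (x::'a) y \<le> \<rho> + d"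
  obtains z where "dist x z \<le> \<rho>" "dist z y \<le> d"
proof (cases "dist x y \<le> \<rho>")
  case True
  then show thesis using assms(3) by (intro that[of y]) auto
next
  case False
  obtain \<gamma> where "geodesic_segment \<gamma> x y" using assms(1) by (auto simp: geodesic_space_def)
  then have ends: "\<gamma> 0 = x" "\<gamma> (dist x y) = y"
    and iso: "\<And>s t. s \<in> {0..dist x y} \<Longrightarrow> t \<in> {0..dist x y} \<Longrightarrow> dist (\<gamma> s) (\<gamma> t) = \<bar>s - t\<bar>"
    by (auto simp: geodesic_segment_def)
  have "dist x (\<gamma> \<rho>) = \<rho>" "dist (\<gamma> \<rho>) y = dist x y - \<rho>"
    using iso[of 0 \<rho>] iso[of \<rho> "dist x y"] ends False assms(2) by auto
  then show thesis using assms(4) by (intro that[of "\<gamma> \<rho>"]) auto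
qed

text \<open>The levels below \<open>v\<close> telescope: \<open>t\<close> plus
  \<open>t * 2 ^ j\<close> over \<open>j \<le> n\<close> equals \<open>t * 2 ^ Suc n\<close>. The
  induction runs on \<open>v\<close> truncated at \<open>t * 2 ^ n\<close>, which also covers
  infinite \<open>v\<close>.\<close>

lemma dyadic_upper_bound:
  fixes v :: ennreal
  assumes "0 < t"
  shows "v \<le> ennreal t + (\<Sum>j. ennreal (t * 2 ^ j) * indicator {u. ennreal (t * 2 ^ j) < u} v)"
    (is "v \<le> ?t + suminf ?f")
proof (rule ccontr)
  have partial: "min v (ennreal (t * 2 ^ n)) \<le> ?t + sum ?f {..<n}" for n
  proof (induction n)
    case (Suc n)
    show ?case
    proof (cases "ennreal (t * 2 ^ n) < v")
      case True
      have "min v (ennreal (t * 2 ^ Suc n)) \<le> ennreal (t * 2 ^ n) + ennreal (t * 2 ^ n)"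
        using assms by (simp add: ennreal_plus[symmetric] min.coboundedI2 del: ennreal_plus)
      also have "\<dots> \<le> (?t + sum ?f {..<n}) + ennreal (t * 2 ^ n)"
        using Suc.IH True by (intro add_right_mono) (simp add: min_def split: if_splits)
      finally show ?thesis using True by (simp add: add.assoc)
    next
      case False
      have "min v (ennreal (t * 2 ^ Suc n)) \<le> v" by simp
      also have "v = min v (ennreal (t * 2 ^ n))" using False by (simp add: min_absorb1)
      also note Suc.IH
      finally show ?thesis using False by simp
    qed
  qed simp
  assume "\<not> ?thesis"
  then have less: "?t + suminf ?f < v" by simp
  then obtain b where b: "?t + suminf ?f = ennreal b" "0 \<le> b"
    by (cases "?t + suminf ?f") auto
  obtain n where "b / t < 2 ^ n" using real_arch_pow[of 2 "b / t"] by auto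
  then have "ennreal b < ennreal (t * 2 ^ n)" using assms b(2) by (simp add: field_simps ennreal_less_iff)
  moreover have "min v (ennreal (t * 2 ^ n)) \<le> ?t + suminf ?f"
    by (rule order_trans[OF partial]) (intro add_left_mono sum_le_suminf, auto)
  ultimately show False using less b(1) by (simp add: min_def split: if_splits)
qed

text \<open>A single \<beta> absorbs the distortion of \<phi>, the distortion of \<psi> and the
  defect of \<psi> as a right inverse, so all radii below are explicit in \<beta>.\<close>

locale rough_isometry =
  fixes \<mu> :: "'a::metric_space measure" and \<nu> :: "'b::metric_space measure"
    and \<phi> :: "'a \<Rightarrow> 'b" and \<psi> :: "'b \<Rightarrow> 'a" and \<beta> :: real
  assumes \<mu>: "uniformly_sized \<mu>" and \<nu>: "uniformly_sized \<nu>" and \<beta>: "0 \<le> \<beta>"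
    and \<phi>_lower: "dist x y \<le> dist (\<phi> x) (\<phi> y) + \<beta>"
    and \<phi>_upper: "dist (\<phi> x) (\<phi> y) \<le> dist x y + \<beta>"
    and \<psi>_lower: "dist a b \<le> dist (\<psi> a) (\<psi> b) + \<beta>"
    and \<psi>_upper: "dist (\<psi> a) (\<psi> b) \<le> dist a b + \<beta>"
    and \<phi>_\<psi>: "dist (\<phi> (\<psi> a)) a \<le> \<beta>"
begin

lemmas sets_borel [measurable_cong] = uniformly_sized_sets[OF \<mu>] uniformly_sized_sets[OF \<nu>]

lemma space_UNIV [simp]: "space \<mu> = UNIV" "space \<nu> = UNIV"
  using sets_eq_imp_space_eq[OF sets_borel(1)] sets_eq_imp_space_eq[OF sets_borel(2)] by auto

text \<open>Transfers mass from \<open>X'\<close> to \<open>X\<close>. The supremum over nearby centres makes it lower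
  semicontinuous, hence measurable, although \<open>\<phi>\<close> and \<open>\<psi>\<close> need not be.\<close>

definition pullback :: "('b \<Rightarrow> ennreal) \<Rightarrow> 'a \<Rightarrow> ennreal" where
  "pullback f w = (SUP a\<in>{a. dist (\<psi> a) w < 1}. \<integral>\<^sup>+ y\<in>ball a 2. f y \<partial>\<nu>)"

lemma less_pullback_iff:
  "t < pullback f w \<longleftrightarrow> (\<exists>a. w \<in> ball (\<psi> a) 1 \<and> t < (\<integral>\<^sup>+ y\<in>ball a 2. f y \<partial>\<nu>))"
  by (auto simp: pullback_def less_SUP_iff)

lemma le_pullback:
  "dist (\<psi> a) w < 1 \<Longrightarrow> (\<integral>\<^sup>+ y\<in>ball a 2. f y \<partial>\<nu>) \<le> pullback f w"
  unfolding pullback_def by (rule SUP_upper) simp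

lemma measurable_pullback [measurable]: "pullback f \<in> borel_measurable borel"
proof (rule borel_measurableI_greater)
  fix t
  have "{w. t < pullback f w} = (\<Union>a\<in>{a. t < (\<integral>\<^sup>+ y\<in>ball a 2. f y \<partial>\<nu>)}. ball (\<psi> a) 1)"
    by (auto simp: less_pullback_iff)
  then have "open {w. t < pullback f w}" by auto
  then show "{w \<in> space borel. t < pullback f w} \<in> sets borel" by simp
qed

section \<open>Averages and maximal functions on \<open>X'\<close> dominated by those of the
  pullback\<close>

lemma ball_integral_le_pullback:
  obtains C where "0 < C" "\<And>f a x r. f \<in> borel_measurable borel \<Longrightarrow> dist (\<psi> a) x \<le> 1 \<Longrightarrow>
    (\<integral>\<^sup>+ y\<in>ball a r. f y \<partial>\<nu>) \<le> ennreal C * (\<integral>\<^sup>+ w\<in>ball x (r + \<beta> + 2). pullback f w \<partial>\<mu>)"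
proof -
  obtain c where c: "0 < c" "\<And>x. ennreal c \<le> emeasure \<mu> (ball x 1)"
    using uniformly_sized_lower[OF \<mu>] by blast
  obtain K where K: "0 < K"
    "\<And>g h A. g \<in> borel_measurable borel \<Longrightarrow> h \<in> borel_measurable borel \<Longrightarrow> A \<in> sets borel \<Longrightarrow>
      (\<And>a. a \<in> A \<Longrightarrow> (\<integral>\<^sup>+ x\<in>ball a 2. g x \<partial>\<nu>) \<le> (\<integral>\<^sup>+ y\<in>ball (\<psi> a) 1. h y \<partial>\<mu>)) \<Longrightarrow>
      (\<integral>\<^sup>+ x\<in>A. g x \<partial>\<nu>) \<le> ennreal K * (\<integral>\<^sup>+ y. h y \<partial>\<mu>)"
    using net_comparison[OF \<nu> sets_borel(1) \<psi>_lower] by blast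
  show thesis
  proof (rule that)
    show "0 < K / c" using K(1) c(1) by simp
  next
    fix f :: "'b \<Rightarrow> ennreal" and a :: 'b and x :: 'a and r :: real
    assume f[measurable]: "f \<in> borel_measurable borel" and x: "dist (\<psi> a) x \<le> 1"
    \<comment> \<open>For \<open>b\<close> in \<open>ball a r\<close> the mass of \<open>f\<close>
      in \<open>ball b 2\<close> is at most \<open>pullback f\<close> throughout the unit ball about
      \<open>\<psi> b\<close>, whose measure is at least \<open>c\<close>. That unit ball lies in
      \<open>?B\<close>: \<beta> comes from \<open>\<psi>_upper\<close>, one unit from the distance
      of \<open>x\<close> to \<open>\<psi> a\<close>, one from the unit ball itself.\<close>
    let ?B = "ball x (r + \<beta> + 2)"
    let ?h = "\<lambda>w. ennreal (1 / c) * (pullback f w * indicator ?B w)"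
    have "(\<integral>\<^sup>+ y\<in>ball a r. f y \<partial>\<nu>) \<le> ennreal K * (\<integral>\<^sup>+ w. ?h w \<partial>\<mu>)"
    proof (rule K(2))
      fix b assume "b \<in> ball a r"
      then have sub: "ball (\<psi> b) 1 \<subseteq> ?B"
        using x \<psi>_upper[of a b] by (auto simp: subset_iff) (smt (verit) dist_triangle dist_commute)
      let ?I = "\<integral>\<^sup>+ y\<in>ball b 2. f y \<partial>\<nu>"
      have "?I = ennreal (1 / c) * (ennreal c * ?I)"
        using c(1) by (simp add: mult.assoc[symmetric] ennreal_mult'[symmetric])
      also have "\<dots> \<le> ennreal (1 / c) * (emeasure \<mu> (ball (\<psi> b) 1) * ?I)"
        by (intro mult_left_mono mult_right_mono c) auto
      also have "\<dots> = (\<integral>\<^sup>+ w. ennreal (1 / c) * (?I * indicator (ball (\<psi> b) 1) w) \<partial>\<mu>)"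
        by (simp add: nn_integral_cmult) (simp add: mult.commute)
      also have "\<dots> \<le> (\<integral>\<^sup>+ w\<in>ball (\<psi> b) 1. ?h w \<partial>\<mu>)"
      proof (intro nn_integral_mono)
        fix w
        show "ennreal (1 / c) * (?I * indicator (ball (\<psi> b) 1) w) \<le> ?h w * indicator (ball (\<psi> b) 1) w"
        proof (cases "w \<in> ball (\<psi> b) 1")
          case True
          then have "?I \<le> pullback f w" by (intro le_pullback) simp
          then show ?thesis using True sub by (auto intro!: mult_left_mono)
        qed simp
      qed
      finally show "?I \<le> (\<integral>\<^sup>+ w\<in>ball (\<psi> b) 1. ?h w \<partial>\<mu>)" .
    qed measurable
    also have "\<dots> = ennreal (K / c) * (\<integral>\<^sup>+ w\<in>?B. pullback f w \<partial>\<mu>)"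
      using K(1) c(1) by (simp add: nn_integral_cmult) (simp add: mult.assoc[symmetric] ennreal_mult'[symmetric])
    finally show "(\<integral>\<^sup>+ y\<in>ball a r. f y \<partial>\<nu>) \<le> ennreal (K / c) * (\<integral>\<^sup>+ w\<in>?B. pullback f w \<partial>\<mu>)" .
  qed
qed

text \<open>The ball on the left is the larger one, so a point \<open>w\<close> of it may have its
  image outside \<open>ball a r\<close>. A geodesic from \<open>a\<close> to \<open>\<phi> w\<close>
  supplies a point near \<open>\<phi> w\<close> whose unit ball does lie in \<open>ball a r\<close>;
  this is where \<open>r > 1\<close> matters.\<close>

lemma ball_measure_le:
  assumes "geodesic_space TYPE('b)"
  obtains C where "0 < C" "\<And>a x r. 1 < r \<Longrightarrow> dist (\<psi> a) x \<le> 1 \<Longrightarrow>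
    emeasure \<mu> (ball x (r + \<beta> + 2)) \<le> ennreal C * emeasure \<nu> (ball a r)"
proof -
  obtain c where c: "0 < c" "\<And>x. ennreal c \<le> emeasure \<nu> (ball x 1)"
    using uniformly_sized_lower[OF \<nu>] by blast
  obtain S where S: "0 < S" "\<And>x. emeasure \<mu> (ball x 2) \<le> ennreal S"
    using uniformly_sized_upper[OF \<mu>] by blast
  obtain K where K: "0 < K"
    "\<And>g h A. g \<in> borel_measurable borel \<Longrightarrow> h \<in> borel_measurable borel \<Longrightarrow> A \<in> sets borel \<Longrightarrow>
      (\<And>a. a \<in> A \<Longrightarrow> (\<integral>\<^sup>+ x\<in>ball a 2. g x \<partial>\<mu>) \<le> (\<integral>\<^sup>+ y\<in>ball (\<phi> a) (3 * \<beta> + 5). h y \<partial>\<nu>)) \<Longrightarrow>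
      (\<integral>\<^sup>+ x\<in>A. g x \<partial>\<mu>) \<le> ennreal K * (\<integral>\<^sup>+ y. h y \<partial>\<nu>)"
    using net_comparison[OF \<mu> sets_borel(2) \<phi>_lower] by blast
  show thesis
  proof (rule that)
    show "0 < K * (S / c)" using K(1) c(1) S(1) by simp
  next
    fix a :: 'b and x :: 'a and r :: real
    assume r: "1 < r" and x: "dist (\<psi> a) x \<le> 1"
    let ?h = "\<lambda>y. ennreal (S / c) * indicator (ball a r) y"
    have "(\<integral>\<^sup>+ w\<in>ball x (r + \<beta> + 2). 1 \<partial>\<mu>) \<le> ennreal K * (\<integral>\<^sup>+ y. ?h y \<partial>\<nu>)"
    proof (rule K(2))
      fix w assume "w \<in> ball x (r + \<beta> + 2)"
      then have "dist (\<psi> a) w < r + \<beta> + 3"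
        using x by simp (smt (verit) dist_triangle)
      then have "dist (\<phi> (\<psi> a)) (\<phi> w) < r + 2 * \<beta> + 3" using \<phi>_upper[of "\<psi> a" w] by simp
      then have "dist a (\<phi> w) \<le> (r - 1) + (3 * \<beta> + 4)"
        using \<phi>_\<psi>[of a] by (smt (verit) dist_triangle dist_commute)
      \<comment> \<open>Stopping at distance \<open>r - 1\<close> from \<open>a\<close> leaves room
        for \<open>ball z 1\<close> in \<open>ball a r\<close>, and one more unit than
        \<open>3 * \<beta> + 4\<close> gives the radius in \<open>K\<close>.\<close>
      then obtain z where z: "dist a z \<le> r - 1" "dist z (\<phi> w) \<le> 3 * \<beta> + 4"
        using geodesic_space_move[OF assms] r \<beta> by (metis add_nonneg_nonneg diff_ge_0_iff_ge less_imp_le mult_nonneg_nonneg zero_le_numeral)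
      have sub: "ball z 1 \<subseteq> ball (\<phi> w) (3 * \<beta> + 5) \<inter> ball a r"
        using z by (auto simp: subset_iff) (smt (verit) dist_triangle dist_commute)+
      have "(\<integral>\<^sup>+ x\<in>ball w 2. 1 \<partial>\<mu>) \<le> ennreal S" using S(2)[of w] by simp
      also have "\<dots> = ennreal (S / c) * ennreal c" using S(1) c(1) by (simp add: ennreal_mult'[symmetric])
      also have "\<dots> \<le> ennreal (S / c) * emeasure \<nu> (ball z 1)" by (intro mult_left_mono c) auto
      also have "\<dots> \<le> ennreal (S / c) * emeasure \<nu> (ball a r \<inter> ball (\<phi> w) (3 * \<beta> + 5))"
        using sub by (intro mult_left_mono emeasure_mono) (auto simp: sets_borel)
      also have "\<dots> = (\<integral>\<^sup>+ y\<in>ball (\<phi> w) (3 * \<beta> + 5). ?h y \<partial>\<nu>)"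
        by (simp add: mult.assoc nn_integral_cmult indicator_inter_arith[symmetric])
      finally show "(\<integral>\<^sup>+ x\<in>ball w 2. 1 \<partial>\<mu>) \<le> (\<integral>\<^sup>+ y\<in>ball (\<phi> w) (3 * \<beta> + 5). ?h y \<partial>\<nu>)" .
    qed measurable
    then show "emeasure \<mu> (ball x (r + \<beta> + 2)) \<le> ennreal (K * (S / c)) * emeasure \<nu> (ball a r)"
      using K(1) by (simp add: nn_integral_cmult ennreal_mult' mult.assoc del: times_divide_eq_right)
  qed
qed

text \<open>Maximal operators act on complex functions while the pullback takes values in
  \<open>[0, \<infinity>]\<close>; \<open>g\<close> stands for a complex function of that modulus.
  The radius only grows, so it stays admissible on \<open>X\<close>.\<close>

lemma ball_average_le_pullback:
  assumes "geodesic_space TYPE('b)"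
  obtains C where "0 < C" "\<And>f g a x r. f \<in> borel_measurable borel \<Longrightarrow>
    (\<And>w. ennreal (norm (g w)) = pullback (\<lambda>y. ennreal (norm (f y))) w) \<Longrightarrow>
    1 < r \<Longrightarrow> dist (\<psi> a) x \<le> 1 \<Longrightarrow>
    ball_average \<nu> f a r \<le> ennreal C * ball_average \<mu> g x (r + \<beta> + 2)"
proof -
  obtain C1 where C1: "0 < C1" "\<And>f a x r. f \<in> borel_measurable borel \<Longrightarrow> dist (\<psi> a) x \<le> 1 \<Longrightarrow>
    (\<integral>\<^sup>+ y\<in>ball a r. f y \<partial>\<nu>) \<le> ennreal C1 * (\<integral>\<^sup>+ w\<in>ball x (r + \<beta> + 2). pullback f w \<partial>\<mu>)"
    using ball_integral_le_pullback by blast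
  obtain C2 where C2: "0 < C2" "\<And>a x r. 1 < r \<Longrightarrow> dist (\<psi> a) x \<le> 1 \<Longrightarrow>
    emeasure \<mu> (ball x (r + \<beta> + 2)) \<le> ennreal C2 * emeasure \<nu> (ball a r)"
    using ball_measure_le[OF assms] by blast
  show thesis
  proof (rule that)
    show "0 < C1 * C2" using C1(1) C2(1) by simp
  next
    fix f :: "'b \<Rightarrow> complex" and g :: "'a \<Rightarrow> complex" and a :: 'b and x :: 'a and r :: real
    assume f[measurable]: "f \<in> borel_measurable borel"
      and g: "\<And>w. ennreal (norm (g w)) = pullback (\<lambda>y. ennreal (norm (f y))) w"
      and r: "1 < r" and x: "dist (\<psi> a) x \<le> 1"
    let ?I = "\<integral>\<^sup>+ w\<in>ball x (r + \<beta> + 2). ennreal (norm (g w)) \<partial>\<mu>"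
    let ?m = "emeasure \<mu> (ball x (r + \<beta> + 2))"
    have "ball_average \<nu> f a r \<le> (ennreal C1 * ?I) / (ennreal (1 / C2) * ?m)"
      unfolding ball_average_def
    proof (rule ennreal_divide_mono)
      show "(\<integral>\<^sup>+ y\<in>ball a r. ennreal (norm (f y)) \<partial>\<nu>) \<le> ennreal C1 * ?I"
        unfolding g by (intro C1(2) x) measurable
      have "ennreal (1 / C2) * ?m \<le> ennreal (1 / C2) * (ennreal C2 * emeasure \<nu> (ball a r))"
        by (intro mult_left_mono C2 r x) simp
      then show "ennreal (1 / C2) * ?m \<le> emeasure \<nu> (ball a r)"
        using C2(1) by (simp add: mult.assoc[symmetric] ennreal_mult'[symmetric])
    qed
    also have "\<dots> = ennreal (C1 * C2) * (?I / ?m)"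
    proof -
      have "inverse (ennreal (1 / C2) * ?m) = ennreal C2 * inverse ?m"
        using C2(1) by (simp add: ennreal_inverse_mult inverse_ennreal uniformly_sized_finite[OF \<mu>, simplified])
      then show ?thesis using C1(1) C2(1) by (simp add: divide_ennreal_def ennreal_mult mult_ac)
    qed
    finally show "ball_average \<nu> f a r \<le> ennreal (C1 * C2) * ball_average \<mu> g x (r + \<beta> + 2)"
      by (simp add: ball_average_def)
  qed
qed

text \<open>The bound is proved on the whole unit ball about \<open>\<psi> a\<close> and not just at
  its centre, because a set in \<open>X'\<close> is later measured through the unit balls about the
  images of its points.\<close>

lemma centred_maximal_le_pullback:
  assumes "geodesic_space TYPE('b)"
  obtains C where "0 < C" "\<And>f g a x. f \<in> borel_measurable borel \<Longrightarrow>
    (\<And>w. ennreal (norm (g w)) = pullback (\<lambda>y. ennreal (norm (f y))) w) \<Longrightarrow>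
    dist (\<psi> a) x < 1 \<Longrightarrow> centred_maximal \<nu> f a \<le> ennreal C * centred_maximal \<mu> g x"
proof -
  obtain C where C: "0 < C" "\<And>f g a x r. f \<in> borel_measurable borel \<Longrightarrow>
    (\<And>w. ennreal (norm (g w)) = pullback (\<lambda>y. ennreal (norm (f y))) w) \<Longrightarrow>
    1 < r \<Longrightarrow> dist (\<psi> a) x \<le> 1 \<Longrightarrow>
    ball_average \<nu> f a r \<le> ennreal C * ball_average \<mu> g x (r + \<beta> + 2)"
    using ball_average_le_pullback[OF assms] by blast
  show thesis
  proof (rule that[OF C(1)])
    fix f :: "'b \<Rightarrow> complex" and g :: "'a \<Rightarrow> complex" and a :: 'b and x :: 'a
    assume f: "f \<in> borel_measurable borel"
      and g: "\<And>w. ennreal (norm (g w)) = pullback (\<lambda>y. ennreal (norm (f y))) w"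
      and x: "dist (\<psi> a) x < 1"
    show "centred_maximal \<nu> f a \<le> ennreal C * centred_maximal \<mu> g x"
      unfolding centred_maximal_def SUP_mult_left_ennreal
    proof (rule SUP_least)
      fix r :: real assume "r \<in> {1<..}"
      then have "ball_average \<nu> f a r \<le> ennreal C * ball_average \<mu> g x (r + \<beta> + 2)"
        using x by (intro C(2) f g) auto
      then show "ball_average \<nu> f a r \<le> (SUP r\<in>{1<..}. ennreal C * ball_average \<mu> g x r)"
        using \<open>r \<in> {1<..}\<close> \<beta> by (intro SUP_upper2[of "r + \<beta> + 2"]) auto
    qed
  qed
qed

text \<open>A ball about \<open>b\<close> containing \<open>a\<close> corresponds to the ball of
  radius \<open>r + \<beta> + 2\<close> about \<open>\<psi> b\<close>, which contains
  \<open>x\<close> since \<psi> adds at most \<beta> and \<open>x\<close> is within 1 of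
  \<open>\<psi> a\<close>.\<close>

lemma uncentred_maximal_le_pullback:
  assumes "geodesic_space TYPE('b)"
  obtains C where "0 < C" "\<And>f g a x. f \<in> borel_measurable borel \<Longrightarrow>
    (\<And>w. ennreal (norm (g w)) = pullback (\<lambda>y. ennreal (norm (f y))) w) \<Longrightarrow>
    dist (\<psi> a) x < 1 \<Longrightarrow> uncentred_maximal \<nu> f a \<le> ennreal C * uncentred_maximal \<mu> g x"
proof -
  obtain C where C: "0 < C" "\<And>f g a x r. f \<in> borel_measurable borel \<Longrightarrow>
    (\<And>w. ennreal (norm (g w)) = pullback (\<lambda>y. ennreal (norm (f y))) w) \<Longrightarrow>
    1 < r \<Longrightarrow> dist (\<psi> a) x \<le> 1 \<Longrightarrow>
    ball_average \<nu> f a r \<le> ennreal C * ball_average \<mu> g x (r + \<beta> + 2)"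
    using ball_average_le_pullback[OF assms] by blast
  show thesis
  proof (rule that[OF C(1)])
    fix f :: "'b \<Rightarrow> complex" and g :: "'a \<Rightarrow> complex" and a :: 'b and x :: 'a
    assume f: "f \<in> borel_measurable borel"
      and g: "\<And>w. ennreal (norm (g w)) = pullback (\<lambda>y. ennreal (norm (f y))) w"
      and x: "dist (\<psi> a) x < 1"
    have "ball_average \<nu> f b r \<le> ennreal C * uncentred_maximal \<mu> g x" if "1 < r" "a \<in> ball b r" for b r
    proof -
      have "dist (\<psi> b) x < r + \<beta> + 2"
        using x \<psi>_upper[of b a] that(2) by (simp, smt (verit) dist_triangle)
      then have "ball_average \<mu> g (\<psi> b) (r + \<beta> + 2) \<le> uncentred_maximal \<mu> g x"
        using that(1) \<beta> unfolding uncentred_maximal_def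
        by (intro SUP_upper2[of "(\<psi> b, r + \<beta> + 2)"]) auto
      moreover have "ball_average \<nu> f b r \<le> ennreal C * ball_average \<mu> g (\<psi> b) (r + \<beta> + 2)"
        using that(1) by (intro C(2) f g) auto
      ultimately show ?thesis by (meson mult_left_mono order_trans zero_le)
    qed
    then show "uncentred_maximal \<nu> f a \<le> ennreal C * uncentred_maximal \<mu> g x"
      unfolding uncentred_maximal_def[of \<nu>] by (intro SUP_least) auto
  qed
qed

section \<open>Measure comparison and Lorentz bounds for the pullback\<close>

lemma nn_integral_pullback_le:
  obtains K where "0 < K"
    "\<And>f. f \<in> borel_measurable borel \<Longrightarrow> (\<integral>\<^sup>+ w. pullback f w \<partial>\<mu>) \<le> ennreal K * (\<integral>\<^sup>+ y. f y \<partial>\<nu>)"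
proof -
  obtain S where S: "0 < S" "\<And>x. emeasure \<mu> (ball x 2) \<le> ennreal S"
    using uniformly_sized_upper[OF \<mu>] by blast
  \<comment> \<open>The centres \<open>b\<close> that enter \<open>pullback f\<close> on
    \<open>ball x 2\<close> have \<open>\<psi> b\<close> within 3 of \<open>x\<close>. Applying
    \<phi> and returning from \<open>\<phi> (\<psi> b)\<close> to \<open>b\<close> adds
    \<open>2 * \<beta>\<close>, and the balls about \<open>b\<close> have radius 2.\<close>
  obtain K where K: "0 < K"
    "\<And>g h A. g \<in> borel_measurable borel \<Longrightarrow> h \<in> borel_measurable borel \<Longrightarrow> A \<in> sets borel \<Longrightarrow>
      (\<And>a. a \<in> A \<Longrightarrow> (\<integral>\<^sup>+ x\<in>ball a 2. g x \<partial>\<mu>) \<le> (\<integral>\<^sup>+ y\<in>ball (\<phi> a) (2 * \<beta> + 5). h y \<partial>\<nu>)) \<Longrightarrow>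
      (\<integral>\<^sup>+ x\<in>A. g x \<partial>\<mu>) \<le> ennreal K * (\<integral>\<^sup>+ y. h y \<partial>\<nu>)"
    using net_comparison[OF \<mu> sets_borel(2) \<phi>_lower] by blast
  show thesis
  proof (rule that)
    show "0 < K * S" using K(1) S(1) by simp
  next
    fix f :: "'b \<Rightarrow> ennreal" assume [measurable]: "f \<in> borel_measurable borel"
    have "(\<integral>\<^sup>+ w\<in>UNIV. pullback f w \<partial>\<mu>) \<le> ennreal K * (\<integral>\<^sup>+ y. ennreal S * f y \<partial>\<nu>)"
    proof (rule K(2))
      fix x
      let ?I = "\<integral>\<^sup>+ y\<in>ball (\<phi> x) (2 * \<beta> + 5). f y \<partial>\<nu>"
      have "pullback f w \<le> ?I" if w: "w \<in> ball x 2" for w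
        unfolding pullback_def
      proof (rule SUP_least)
        fix b assume "b \<in> {b. dist (\<psi> b) w < 1}"
        then have "dist x (\<psi> b) < 3" using w by (simp, smt (verit) dist_triangle2)
        then have "dist (\<phi> x) b < 2 * \<beta> + 3"
          using \<phi>_upper[of x "\<psi> b"] \<phi>_\<psi>[of b] by (smt (verit) dist_triangle)
        then have "ball b 2 \<subseteq> ball (\<phi> x) (2 * \<beta> + 5)"
          by (auto simp: subset_iff) (smt (verit) dist_triangle)
        then show "(\<integral>\<^sup>+ y\<in>ball b 2. f y \<partial>\<nu>) \<le> ?I"
          by (intro nn_integral_mono mult_left_mono) (auto simp: indicator_def)
      qed
      then have "(\<integral>\<^sup>+ w\<in>ball x 2. pullback f w \<partial>\<mu>) \<le> (\<integral>\<^sup>+ w. ?I * indicator (ball x 2) w \<partial>\<mu>)"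
        by (intro nn_integral_mono) (simp add: indicator_def)
      also have "\<dots> = ?I * emeasure \<mu> (ball x 2)" by (simp add: nn_integral_cmult)
      also have "\<dots> \<le> ?I * ennreal S" by (intro mult_left_mono S) simp
      also have "\<dots> = (\<integral>\<^sup>+ y\<in>ball (\<phi> x) (2 * \<beta> + 5). ennreal S * f y \<partial>\<nu>)"
        by (simp add: nn_integral_cmult mult.assoc mult.commute[of _ "ennreal S"])
      finally show "(\<integral>\<^sup>+ w\<in>ball x 2. pullback f w \<partial>\<mu>) \<le> (\<integral>\<^sup>+ y\<in>ball (\<phi> x) (2 * \<beta> + 5). ennreal S * f y \<partial>\<nu>)" .
    qed measurable
    then show "(\<integral>\<^sup>+ w. pullback f w \<partial>\<mu>) \<le> ennreal (K * S) * (\<integral>\<^sup>+ y. f y \<partial>\<nu>)"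
      using K(1) by (simp add: nn_integral_cmult ennreal_mult' mult.assoc del: times_divide_eq_right)
  qed
qed

text \<open>Each point of \<open>E\<close> sees a fixed amount of \<open>G\<close> near its image
  under \<psi>. A nonmeasurable \<open>E\<close> has \<open>emeasure\<close> 0, so superlevel sets
  of an arbitrary operator may be inserted for \<open>E\<close>.\<close>

lemma emeasure_le_of_ball_subset:
  obtains K where "0 < K" "\<And>E G. G \<in> sets borel \<Longrightarrow> (\<And>a. a \<in> E \<Longrightarrow> ball (\<psi> a) 1 \<subseteq> G) \<Longrightarrow>
    emeasure \<nu> E \<le> ennreal K * emeasure \<mu> G"
proof -
  obtain S where S: "0 < S" "\<And>x. emeasure \<nu> (ball x 2) \<le> ennreal S"
    using uniformly_sized_upper[OF \<nu>] by blast
  obtain c where c: "0 < c" "\<And>x. ennreal c \<le> emeasure \<mu> (ball x 1)"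
    using uniformly_sized_lower[OF \<mu>] by blast
  obtain K where K: "0 < K"
    "\<And>g h A. g \<in> borel_measurable borel \<Longrightarrow> h \<in> borel_measurable borel \<Longrightarrow> A \<in> sets borel \<Longrightarrow>
      (\<And>a. a \<in> A \<Longrightarrow> (\<integral>\<^sup>+ x\<in>ball a 2. g x \<partial>\<nu>) \<le> (\<integral>\<^sup>+ y\<in>ball (\<psi> a) 1. h y \<partial>\<mu>)) \<Longrightarrow>
      (\<integral>\<^sup>+ x\<in>A. g x \<partial>\<nu>) \<le> ennreal K * (\<integral>\<^sup>+ y. h y \<partial>\<mu>)"
    using net_comparison[OF \<nu> sets_borel(1) \<psi>_lower] by blast
  show thesis
  proof (rule that)
    show "0 < K * (S / c)" using K(1) S(1) c(1) by simp
  next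
    fix E :: "'b set" and G :: "'a set"
    assume G[measurable]: "G \<in> sets borel" and sub: "\<And>a. a \<in> E \<Longrightarrow> ball (\<psi> a) 1 \<subseteq> G"
    show "emeasure \<nu> E \<le> ennreal (K * (S / c)) * emeasure \<mu> G"
    proof (cases "E \<in> sets borel")
      case E[measurable]: True
      have "(\<integral>\<^sup>+ y\<in>E. 1 \<partial>\<nu>) \<le> ennreal K * (\<integral>\<^sup>+ w. ennreal (S / c) * indicator G w \<partial>\<mu>)"
      proof (rule K(2))
        fix a assume "a \<in> E"
        have "(\<integral>\<^sup>+ x\<in>ball a 2. 1 \<partial>\<nu>) \<le> ennreal S" using S(2)[of a] by simp
        also have "\<dots> = ennreal (S / c) * ennreal c" using S(1) c(1) by (simp add: ennreal_mult'[symmetric])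
        also have "\<dots> \<le> ennreal (S / c) * emeasure \<mu> (ball (\<psi> a) 1)" by (intro mult_left_mono c) auto
        also have "ball (\<psi> a) 1 = G \<inter> ball (\<psi> a) 1" using sub[OF \<open>a \<in> E\<close>] by blast
        also have "ennreal (S / c) * emeasure \<mu> (G \<inter> ball (\<psi> a) 1) = (\<integral>\<^sup>+ w\<in>ball (\<psi> a) 1. ennreal (S / c) * indicator G w \<partial>\<mu>)"
          by (simp add: mult.assoc nn_integral_cmult indicator_inter_arith[symmetric])
        finally show "(\<integral>\<^sup>+ x\<in>ball a 2. 1 \<partial>\<nu>) \<le> (\<integral>\<^sup>+ w\<in>ball (\<psi> a) 1. ennreal (S / c) * indicator G w \<partial>\<mu>)" .
      qed measurable
      then show ?thesis
        using K(1) by (simp add: nn_integral_cmult ennreal_mult' mult.assoc del: times_divide_eq_right)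
    next
      case False
      then show ?thesis by (simp add: emeasure_notin_sets sets_borel)
    qed
  qed
qed

text \<open>A large integral over a 2-ball forces some dyadic level set to be large there. On a
  one-point space a single level suffices, whatever \<open>\<theta>\<close>.\<close>

lemma large_level_set:
  fixes \<theta> :: real
  assumes "1 < \<theta> \<or> (\<forall>a b::'b. a = b)"
  obtains c \<delta> where "0 < c" "0 < \<delta>"
    "\<And>f a \<alpha>. f \<in> borel_measurable borel \<Longrightarrow> 0 < \<alpha> \<Longrightarrow> ennreal \<alpha> < (\<integral>\<^sup>+ y\<in>ball a 2. f y \<partial>\<nu>) \<Longrightarrow>
      \<exists>j::nat. ennreal (\<delta> * 2 powr - (\<theta> * j)) \<le> emeasure \<nu> (ball a 2 \<inter> {y. ennreal (c * 2 ^ j * \<alpha>) < f y})"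
proof (cases "1 < \<theta>")
  case True
  obtain S where S: "0 < S" "\<And>x. emeasure \<nu> (ball x 2) \<le> ennreal S"
    using uniformly_sized_upper[OF \<nu>] by blast
  \<comment> \<open>Ratio of consecutive terms when the level \<open>t * 2 ^ j\<close> is weighted
    by a measure of order \<open>2 powr - (\<theta> * j)\<close>; it is below 1 because
    \<open>1 < \<theta>\<close>.\<close>
  define q where "q = (2::real) powr (1 - \<theta>)"
  have q: "0 < q" "q < 1" using True by (auto simp: q_def powr_less_one)
  have geo: "summable (\<lambda>j. q ^ j)" using q by (intro summable_geometric) simp
  define G where "G = (\<Sum>j. q ^ j)"
  have G: "0 < G" unfolding G_def using q by (intro suminf_pos geo) simp
  \<comment> \<open>The constants split \<alpha> in half. Were all level sets small, the base level
    \<open>t = \<alpha> / (2 * S)\<close> would contribute at most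
    \<open>t * S = \<alpha> / 2\<close>, and the dyadic levels at most
    \<open>t * (S / G) * G\<close>, again \<open>\<alpha> / 2\<close>.\<close>
  show thesis
  proof (rule that[of "1 / (2 * S)" "S / G"])
    fix f :: "'b \<Rightarrow> ennreal" and a :: 'b and \<alpha> :: real
    assume [measurable]: "f \<in> borel_measurable borel" and \<alpha>: "0 < \<alpha>"
      and gt: "ennreal \<alpha> < (\<integral>\<^sup>+ y\<in>ball a 2. f y \<partial>\<nu>)"
    define t where "t = \<alpha> / (2 * S)"
    have t: "0 < t" using \<alpha> S(1) by (simp add: t_def)
    let ?F = "\<lambda>j::nat. {y. ennreal (t * 2 ^ j) < f y}"
    show "\<exists>j::nat. ennreal (S / G * 2 powr - (\<theta> * j)) \<le> emeasure \<nu> (ball a 2 \<inter> {y. ennreal (1 / (2 * S) * 2 ^ j * \<alpha>) < f y})"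
    proof (rule ccontr)
      assume "\<not> ?thesis"
      then have small: "emeasure \<nu> (?F j \<inter> ball a 2) \<le> ennreal (S / G * 2 powr - (\<theta> * j))" for j :: nat
        by (simp add: t_def mult_ac not_le Int_commute less_imp_le)
      have "(\<integral>\<^sup>+ y\<in>ball a 2. f y \<partial>\<nu>) \<le> (\<integral>\<^sup>+ y. ennreal t * indicator (ball a 2) y
           + (\<Sum>j. ennreal (t * 2 ^ j) * indicator (?F j \<inter> ball a 2) y) \<partial>\<nu>)"
      proof (intro nn_integral_mono)
        fix y
        show "f y * indicator (ball a 2) y \<le> ennreal t * indicator (ball a 2) y
           + (\<Sum>j. ennreal (t * 2 ^ j) * indicator (?F j \<inter> ball a 2) y)"
          using dyadic_upper_bound[OF t, of "f y"] by (simp add: indicator_def)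
      qed
      also have "\<dots> = ennreal t * emeasure \<nu> (ball a 2) + (\<Sum>j. ennreal (t * 2 ^ j) * emeasure \<nu> (?F j \<inter> ball a 2))"
        by (simp add: nn_integral_add nn_integral_suminf nn_integral_cmult)
      also have "\<dots> \<le> ennreal t * ennreal S + (\<Sum>j. ennreal (t * 2 ^ j) * ennreal (S / G * 2 powr - (\<theta> * real j)))"
        by (intro add_mono mult_left_mono S suminf_le small) auto
      also have "(\<lambda>j. ennreal (t * 2 ^ j) * ennreal (S / G * 2 powr - (\<theta> * real j))) = (\<lambda>j. ennreal (t * S / G * q ^ j))"
        using t S(1) G by (intro ext) (simp add: ennreal_mult'[symmetric] q_def powr_realpow[symmetric] powr_powr powr_add[symmetric] algebra_simps)
      also have "(\<Sum>j. ennreal (t * S / G * q ^ j)) = ennreal (t * S / G * G)"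
      proof (rule suminf_ennreal_eq)
        show "(\<lambda>j. t * S / G * q ^ j) sums (t * S / G * G)"
          unfolding G_def by (rule sums_mult[OF summable_sums[OF geo]])
      qed (use t S(1) G q in simp)
      also have "ennreal t * ennreal S + ennreal (t * S / G * G) = ennreal \<alpha>"
        using t S(1) G \<alpha> by (simp add: ennreal_mult'[symmetric] ennreal_plus[symmetric] t_def del: ennreal_plus)
      finally show False using gt by simp
    qed
  qed (use S G in auto)
next
  case False
  then have point: "a = b" for a b :: 'b using assms by blast
  define a0 where "a0 = (undefined :: 'b)"
  have ball: "ball a 2 = UNIV" for a :: 'b using point by (auto simp: ball_def) (metis dist_self zero_less_numeral)
  obtain m where m: "emeasure \<nu> UNIV = ennreal m" "0 < m"
  proof -
    obtain c where c: "0 < c" "\<And>x. ennreal c \<le> emeasure \<nu> (ball x 1)"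
      using uniformly_sized_lower[OF \<nu>] by blast
    have "ennreal c \<le> emeasure \<nu> UNIV"
      by (rule order_trans[OF c(2)[of a0]]) (auto intro!: emeasure_mono simp: sets_borel)
    moreover have "emeasure \<nu> UNIV < top" using uniformly_sized_finite[OF \<nu>, of a0 2] by (simp add: ball)
    ultimately show thesis using c(1) by (cases "emeasure \<nu> UNIV") (auto intro!: that simp: ennreal_le_iff)
  qed
  show thesis
  proof (rule that[of "1 / m" m])
    fix f :: "'b \<Rightarrow> ennreal" and a :: 'b and \<alpha> :: real
    assume \<alpha>: "0 < \<alpha>" and gt: "ennreal \<alpha> < (\<integral>\<^sup>+ y\<in>ball a 2. f y \<partial>\<nu>)"
    have "(\<integral>\<^sup>+ y\<in>ball a 2. f y \<partial>\<nu>) = (\<integral>\<^sup>+ y. f a \<partial>\<nu>)"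
      by (intro nn_integral_cong) (use point in \<open>auto simp: ball intro: arg_cong[of _ _ f]\<close>)
    then have "ennreal \<alpha> < ennreal m * f a" using gt m by (simp add: mult.commute)
    then have "ennreal (\<alpha> / m) < f a"
      using m(2) \<alpha> by (cases "f a") (auto simp: ennreal_mult'[symmetric] ennreal_less_iff field_simps)
    then have "{y. ennreal (1 / m * 2 ^ 0 * \<alpha>) < f y} = UNIV"
      using point by auto metis
    then show "\<exists>j::nat. ennreal (m * 2 powr - (\<theta> * j)) \<le> emeasure \<nu> (ball a 2 \<inter> {y. ennreal (1 / m * 2 ^ j * \<alpha>) < f y})"
      using m by (intro exI[of _ 0]) (simp add: ball)
  qed (use m in auto)
qed

text \<open>At \<open>p = r = 1\<close> this is the integral bound. Otherwise a restricted weak type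
  estimate is applied to each dyadic level set of \<open>f\<close>, with \<theta> large enough for
  \<open>large_level_set\<close> and still below \<open>p\<close>.\<close>

lemma lorentz_norm_pullback_le:
  assumes "1 \<le> p" "1 \<le> r" and alt: "1 < p \<or> r = 1 \<or> (\<forall>a b::'b. a = b)"
  obtains L where "\<And>f. f \<in> borel_measurable borel \<Longrightarrow>
    lorentz_norm \<mu> p r (pullback f) \<le> ennreal L * lorentz_norm \<nu> p r f"
proof -
  obtain K where K: "0 < K"
    "\<And>f. f \<in> borel_measurable borel \<Longrightarrow> (\<integral>\<^sup>+ w. pullback f w \<partial>\<mu>) \<le> ennreal K * (\<integral>\<^sup>+ y. f y \<partial>\<nu>)"
    using nn_integral_pullback_le by blast
  show thesis
  proof (cases "1 < p \<or> (\<forall>a b::'b. a = b)")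
    case False
    then have eq: "p = 1" "r = 1" using assms by auto
    show thesis
    proof (rule that[of K])
      fix f :: "'b \<Rightarrow> ennreal" assume "f \<in> borel_measurable borel"
      then show "lorentz_norm \<mu> p r (pullback f) \<le> ennreal K * lorentz_norm \<nu> p r f"
        using K(2)[of f] unfolding eq
        by (simp add: lorentz_norm_one_one uniformly_sized_sigma_finite[OF \<mu>] uniformly_sized_sigma_finite[OF \<nu>]
          measurable_cong_sets[OF sets_borel(1)] measurable_cong_sets[OF sets_borel(2)])
    qed
  next
    case True
    \<comment> \<open>Halfway between 1 and \<open>p\<close>. When \<open>p = 1\<close> the space
      \<open>X'\<close> is a point, and there \<open>large_level_set\<close> holds with any
      \<theta>.\<close>
    define \<theta> where "\<theta> = (if 1 < p then (1 + p) / 2 else 0)"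
    have \<theta>: "\<theta> < p" "1 < \<theta> \<or> (\<forall>a b::'b. a = b)" using True assms(1) by (auto simp: \<theta>_def)
    \<comment> \<open>The gap between \<theta> and \<eta> pays for replacing the sum over levels by
      the supremum required in \<open>lorentz_norm_le_of_distribution_le\<close>; the price is the
      geometric series \<open>W\<close>.\<close>
    define \<eta> where "\<eta> = (\<theta> + p) / 2"
    have \<eta>: "\<theta> < \<eta>" "\<eta> < p" using \<theta>(1) by (auto simp: \<eta>_def)
    define W where "W = (\<Sum>j. (2 powr (\<theta> - \<eta>)) ^ j :: real)"
    have geo: "summable (\<lambda>j. (2 powr (\<theta> - \<eta>)) ^ j :: real)"
      using \<eta>(1) by (intro summable_geometric) (simp add: powr_less_one)
    have W: "0 < W" unfolding W_def by (intro suminf_pos geo) simp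
    obtain c \<delta> where c: "0 < c" "0 < \<delta>" and level:
      "\<And>f a \<alpha>. f \<in> borel_measurable borel \<Longrightarrow> 0 < \<alpha> \<Longrightarrow> ennreal \<alpha> < (\<integral>\<^sup>+ y\<in>ball a 2. f y \<partial>\<nu>) \<Longrightarrow>
        \<exists>j::nat. ennreal (\<delta> * 2 powr - (\<theta> * j)) \<le> emeasure \<nu> (ball a 2 \<inter> {y. ennreal (c * 2 ^ j * \<alpha>) < f y})"
      using large_level_set[OF \<theta>(2)] by blast
    define A where "A = K / \<delta> * W"
    have A: "0 < A" using K(1) c W by (simp add: A_def)
    obtain C where C: "0 < C" "\<And>u v. v \<in> borel_measurable \<nu> \<Longrightarrow>
       (\<And>\<alpha>. 0 < \<alpha> \<Longrightarrow> distribution \<mu> u \<alpha>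
          \<le> ennreal A * (SUP j::nat. ennreal (2 powr (\<eta> * j)) * distribution \<nu> v (c * 2 ^ j * \<alpha>))) \<Longrightarrow>
       lorentz_norm \<mu> p r u \<le> ennreal C * lorentz_norm \<nu> p r v"
      using lorentz_norm_le_of_distribution_le[where M = \<mu> and N = \<nu>, OF assms(1,2) \<eta>(2) A c(1)]
      by blast
    show thesis
    proof (rule that[of C], rule C(2))
      fix f :: "'b \<Rightarrow> ennreal" and \<alpha> :: real
      assume f[measurable]: "f \<in> borel_measurable borel" and \<alpha>: "0 < \<alpha>"
      let ?F = "\<lambda>j::nat. {y. ennreal (c * 2 ^ j * \<alpha>) < f y}"
      \<comment> \<open>Where the pullback exceeds \<alpha>, some level set is large in a 2-ball, so
        the point lies in some \<open>E j\<close>. The measure of \<open>E j\<close> follows from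
        Chebyshev and the integral bound for the pullback of the indicator.\<close>
      define E where "E j = {w. ennreal (\<delta> * 2 powr - (\<theta> * real j)) \<le> pullback (indicator (?F j)) w}" for j :: nat
      have E_sets: "E j \<in> sets borel" for j unfolding E_def by measurable
      have "{w. ennreal \<alpha> < pullback f w} \<subseteq> (\<Union>j. E j)"
      proof
        fix w assume "w \<in> {w. ennreal \<alpha> < pullback f w}"
        then obtain a where a: "w \<in> ball (\<psi> a) 1" "ennreal \<alpha> < (\<integral>\<^sup>+ y\<in>ball a 2. f y \<partial>\<nu>)"
          by (auto simp: less_pullback_iff)
        obtain j :: nat where "ennreal (\<delta> * 2 powr - (\<theta> * j)) \<le> emeasure \<nu> (ball a 2 \<inter> ?F j)"
          using level[OF f \<alpha> a(2)] by blast
        also have "\<dots> = (\<integral>\<^sup>+ y\<in>ball a 2. indicator (?F j) y \<partial>\<nu>)"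
          by (simp add: Int_commute indicator_inter_arith[symmetric])
        also have "\<dots> \<le> pullback (indicator (?F j)) w" using a(1) by (intro le_pullback) simp
        finally show "w \<in> (\<Union>j. E j)" by (auto simp: E_def)
      qed
      then have "distribution \<mu> (pullback f) \<alpha> \<le> emeasure \<mu> (\<Union>j. E j)"
        using E_sets by (intro emeasure_mono) (auto simp: sets_borel)
      also have "\<dots> \<le> (\<Sum>j. emeasure \<mu> (E j))"
        using E_sets by (intro emeasure_subadditive_countably) (auto simp: sets_borel)
      also have "\<dots> \<le> (\<Sum>j. ennreal (K / \<delta> * 2 powr (\<theta> * real j)) * emeasure \<nu> (?F j))"
      proof (intro suminf_le)
        fix j :: nat
        let ?e = "\<delta> / 2 powr (\<theta> * real j)"
        have e: "0 < ?e" using c by simp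
        have "emeasure \<mu> (E j) = ennreal (1 / ?e) * (\<integral>\<^sup>+ w. ennreal ?e * indicator (E j) w \<partial>\<mu>)"
        proof -
          have "ennreal (1 / ?e) * ennreal ?e = 1"
            using c by (subst ennreal_mult'[symmetric]) auto
          moreover have "(\<integral>\<^sup>+ w. ennreal ?e * indicator (E j) w \<partial>\<mu>) = ennreal ?e * emeasure \<mu> (E j)"
            using E_sets by (simp add: nn_integral_cmult sets_borel)
          ultimately show ?thesis by (simp only: mult.assoc[symmetric]) simp
        qed
        also have "\<dots> \<le> ennreal (1 / ?e) * (\<integral>\<^sup>+ w. pullback (indicator (?F j)) w \<partial>\<mu>)"
          by (intro mult_left_mono nn_integral_mono)
             (auto simp: E_def indicator_def powr_minus divide_inverse)
        also have "\<dots> \<le> ennreal (1 / ?e) * (ennreal K * (\<integral>\<^sup>+ y. indicator (?F j) y \<partial>\<nu>))"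
          by (intro mult_left_mono K(2)) measurable
        also have "\<dots> = ennreal (K / \<delta> * 2 powr (\<theta> * real j)) * emeasure \<nu> (?F j)"
          using K(1) c by (simp add: mult.assoc[symmetric] ennreal_mult'[symmetric] mult.commute)
        finally show "emeasure \<mu> (E j) \<le> ennreal (K / \<delta> * 2 powr (\<theta> * real j)) * emeasure \<nu> (?F j)" .
      qed auto
      also have "\<dots> \<le> (\<Sum>j. ennreal (K / \<delta> * (2 powr (\<theta> - \<eta>)) ^ j) *
          (SUP j::nat. ennreal (2 powr (\<eta> * j)) * emeasure \<nu> (?F j)))"
      proof (intro suminf_le)
        fix j :: nat
        have split: "2 powr (\<theta> * real j) = (2 powr (\<theta> - \<eta>)) ^ j * 2 powr (\<eta> * real j)"
          by (simp add: powr_realpow[symmetric] powr_powr powr_add[symmetric] left_diff_distrib)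
        have "ennreal (K / \<delta> * 2 powr (\<theta> * real j)) * emeasure \<nu> (?F j)
          = ennreal (K / \<delta> * (2 powr (\<theta> - \<eta>)) ^ j) * (ennreal (2 powr (\<eta> * j)) * emeasure \<nu> (?F j))"
          unfolding split using K(1) c
          by (subst mult.assoc[symmetric], subst ennreal_mult[symmetric]) (auto simp: mult.assoc)
        also have "\<dots> \<le> ennreal (K / \<delta> * (2 powr (\<theta> - \<eta>)) ^ j) *
          (SUP j::nat. ennreal (2 powr (\<eta> * j)) * emeasure \<nu> (?F j))"
          by (intro mult_left_mono SUP_upper) auto
        finally show "ennreal (K / \<delta> * 2 powr (\<theta> * real j)) * emeasure \<nu> (?F j) \<le> \<dots>" .
      qed auto
      also have "\<dots> = ennreal A * (SUP j::nat. ennreal (2 powr (\<eta> * j)) * emeasure \<nu> (?F j))"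
      proof -
        have "(\<Sum>j. ennreal (K / \<delta> * (2 powr (\<theta> - \<eta>)) ^ j)) = ennreal A"
        proof (rule suminf_ennreal_eq)
          show "(\<lambda>j. K / \<delta> * (2 powr (\<theta> - \<eta>)) ^ j) sums A"
            unfolding A_def W_def by (rule sums_mult[OF summable_sums[OF geo]])
        qed (use K(1) c in simp)
        then show ?thesis by simp
      qed
      finally show "distribution \<mu> (pullback f) \<alpha>
          \<le> ennreal A * (SUP j::nat. ennreal (2 powr (\<eta> * j)) * distribution \<nu> f (c * 2 ^ j * \<alpha>))" by simp
    qed (simp add: measurable_cong_sets[OF sets_borel(2)])
  qed
qed

section \<open>Boundedness carried from \<open>X\<close> to \<open>X'\<close>\<close>

lemma pullback_finite:
  assumes "1 \<le> p" "1 \<le> r" "lorentz_norm \<mu> p r (pullback f) < \<infinity>"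
  shows "pullback f w < \<infinity>"
proof (rule ccontr)
  assume "\<not> ?thesis"
  then have inf: "pullback f w = top" by (simp add: less_top[symmetric])
  obtain c where c: "0 < c" "\<And>x. ennreal c \<le> emeasure \<mu> (ball x 1)"
    using uniformly_sized_lower[OF \<mu>] by blast
  \<comment> \<open>An infinite value at one point propagates: for every \<open>t\<close> some
    2-ball has mass above \<open>t\<close>, and then the pullback exceeds \<open>t\<close> on a
    whole unit ball, of measure at least \<open>c\<close>. A finite norm excludes this for large
    \<open>t\<close>.\<close>
  have bound: "ennreal (t * c powr (1 / p)) \<le> lorentz_norm \<mu> p r (pullback f)" if t: "0 < t" for t
  proof -
    obtain a where a: "ennreal t < (\<integral>\<^sup>+ y\<in>ball a 2. f y \<partial>\<nu>)"
      using inf less_pullback_iff[of "ennreal t" f w] by auto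
    have "ennreal c \<le> emeasure \<mu> (ball (\<psi> a) 1)" by (rule c)
    also have "\<dots> \<le> distribution \<mu> (pullback f) t"
    proof (rule emeasure_mono)
      show "ball (\<psi> a) 1 \<subseteq> {x \<in> space \<mu>. ennreal t < pullback f x}"
        using a by (auto simp: less_pullback_iff)
    qed measurable
    finally have "ennpowr (ennreal c) (1 / p) \<le> ennpowr (distribution \<mu> (pullback f) t) (1 / p)"
      using assms(1) by (intro ennpowr_mono) auto
    then have "ennreal t * ennpowr (ennreal c) (1 / p) \<le> ennreal t * ennpowr (distribution \<mu> (pullback f) t) (1 / p)"
      by (intro mult_left_mono) auto
    also have "\<dots> \<le> lorentz_norm \<mu> p r (pullback f)"
      using assms(1,2) t by (intro lorentz_norm_Chebyshev) (auto simp: measurable_cong_sets[OF sets_borel(1)])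
    finally show ?thesis using c(1) t by (simp add: ennreal_mult')
  qed
  obtain b where b: "lorentz_norm \<mu> p r (pullback f) = ennreal b" "0 \<le> b"
    using assms(3) by (cases "lorentz_norm \<mu> p r (pullback f)") auto
  have "ennreal (b + 1) \<le> ennreal b"
    using bound[of "(b + 1) / c powr (1 / p)"] b c(1) by simp
  then show False using b(2) by (simp add: ennreal_le_iff del: ennreal_plus)
qed

text \<open>Serves both operators. If \<open>T' f\<close> exceeds \<alpha> at \<open>a\<close>, then
  \<open>T g\<close> exceeds \<open>\<alpha> / C\<close> on the unit ball about
  \<open>\<psi> a\<close>, so the distribution functions compare. Passing from \<open>T' f\<close>
  to \<open>T g\<close> uses the exponent \<open>s\<close>, passing from \<open>g\<close> back to
  \<open>f\<close> uses \<open>r\<close>.\<close>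

lemma lorentz_bounded_transfer:
  assumes "1 \<le> p" "1 \<le> r" "1 \<le> s" "0 < C"
    and T: "\<And>g. g \<in> borel_measurable borel \<Longrightarrow> T g \<in> borel_measurable borel"
    and dom: "\<And>f g a x. f \<in> borel_measurable borel \<Longrightarrow>
      (\<And>w. ennreal (norm (g w)) = pullback (\<lambda>y. ennreal (norm (f y))) w) \<Longrightarrow>
      dist (\<psi> a) x < 1 \<Longrightarrow> T' f a \<le> ennreal C * T g x"
    and alt: "1 < p \<or> r = 1 \<or> (\<forall>a b::'b. a = b)"
    and bdd: "lorentz_bounded \<mu> p r s T"
  shows "lorentz_bounded \<nu> p r s T'"
proof -
  obtain L where L: "\<And>f. f \<in> borel_measurable borel \<Longrightarrow>
    lorentz_norm \<mu> p r (pullback f) \<le> ennreal L * lorentz_norm \<nu> p r f"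
    using lorentz_norm_pullback_le[OF assms(1,2) alt] by blast
  obtain K where K: "0 < K" "\<And>E G. G \<in> sets borel \<Longrightarrow> (\<And>a. a \<in> E \<Longrightarrow> ball (\<psi> a) 1 \<subseteq> G) \<Longrightarrow>
    emeasure \<nu> E \<le> ennreal K * emeasure \<mu> G"
    using emeasure_le_of_ball_subset by blast
  have "0 < p" "0 < 1 / C" using assms(1,4) by auto
  \<comment> \<open>With \<open>\<theta> = 0\<close> and only the term \<open>j = 0\<close> used
    below, this is the plain comparison of distribution functions dilated by
    \<open>1 / C\<close>.\<close>
  obtain Q where Q: "0 < Q" "\<And>u v. v \<in> borel_measurable \<mu> \<Longrightarrow>
       (\<And>\<alpha>. 0 < \<alpha> \<Longrightarrow> distribution \<nu> u \<alpha>
          \<le> ennreal K * (SUP j::nat. ennreal (2 powr (0 * real j)) * distribution \<mu> v (1 / C * 2 ^ j * \<alpha>))) \<Longrightarrow>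
       lorentz_norm \<nu> p s u \<le> ennreal Q * lorentz_norm \<mu> p s v"
    using lorentz_norm_le_of_distribution_le[where M = \<nu> and N = \<mu>, OF assms(1,3) \<open>0 < p\<close> K(1) \<open>0 < 1 / C\<close>]
    by blast
  obtain M :: real where M: "\<And>g. g \<in> lorentz_space \<mu> p r \<Longrightarrow>
      lorentz_norm \<mu> p s (T g) \<le> ennreal M * lorentz_norm \<mu> p r (\<lambda>x. ennreal (norm (g x)))"
    using bdd unfolding lorentz_bounded_def by blast
  have "lorentz_norm \<nu> p s (T' f) \<le> ennreal (Q * (max M 0 * max L 0)) * lorentz_norm \<nu> p r (\<lambda>x. ennreal (norm (f x)))"
    if f: "f \<in> lorentz_space \<nu> p r" for f
  proof -
    let ?f = "\<lambda>y. ennreal (norm (f y))"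
    have meas[measurable]: "f \<in> borel_measurable borel" and fin: "lorentz_norm \<nu> p r ?f < \<infinity>"
      using f by (auto simp: lorentz_space_def measurable_cong_sets[OF sets_borel(2)])
    have le: "lorentz_norm \<mu> p r (pullback ?f) \<le> ennreal L * lorentz_norm \<nu> p r ?f" by (rule L) measurable
    also have "\<dots> < \<infinity>" using fin by (simp add: ennreal_mult_less_top)
    finally have finp: "lorentz_norm \<mu> p r (pullback ?f) < \<infinity>" .
    \<comment> \<open>\<open>pullback_finite\<close> makes the conversion to a real number lossless
      at every point.\<close>
    define g where "g w = complex_of_real (enn2real (pullback ?f w))" for w
    have g: "ennreal (norm (g w)) = pullback ?f w" for w
      using pullback_finite[OF assms(1,2) finp, of w] by (simp add: g_def)
    have g_meas[measurable]: "g \<in> borel_measurable borel" unfolding g_def by measurable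
    have "g \<in> lorentz_space \<mu> p r"
      using finp by (simp add: lorentz_space_def g measurable_cong_sets[OF sets_borel(1)])
    from M[OF this] have Mg: "lorentz_norm \<mu> p s (T g) \<le> ennreal M * lorentz_norm \<mu> p r (pullback ?f)"
      by (simp add: g)
    have "lorentz_norm \<nu> p s (T' f) \<le> ennreal Q * lorentz_norm \<mu> p s (T g)"
    proof (rule Q(2))
      show "T g \<in> borel_measurable \<mu>" using T[OF g_meas] by (simp add: measurable_cong_sets[OF sets_borel(1)])
      fix \<alpha> :: real assume \<alpha>: "0 < \<alpha>"
      have "distribution \<nu> (T' f) \<alpha> \<le> ennreal K * distribution \<mu> (T g) (1 / C * \<alpha>)"
      proof (rule K(2))
        show "{x \<in> space \<mu>. ennreal (1 / C * \<alpha>) < T g x} \<in> sets borel"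
          using T[OF g_meas] by measurable
        fix a assume "a \<in> {x \<in> space \<nu>. ennreal \<alpha> < T' f x}"
        then have a: "ennreal \<alpha> < T' f a" by simp
        show "ball (\<psi> a) 1 \<subseteq> {x \<in> space \<mu>. ennreal (1 / C * \<alpha>) < T g x}"
        proof
          fix x assume "x \<in> ball (\<psi> a) 1"
          then have "ennreal \<alpha> < ennreal C * T g x"
            using order.strict_trans2[OF a dom[OF meas g]] by simp
          then have "ennreal (1 / C * \<alpha>) < T g x"
            using \<alpha> assms(4) by (cases "T g x") (auto simp: ennreal_mult'[symmetric] ennreal_less_iff field_simps)
          then show "x \<in> {x \<in> space \<mu>. ennreal (1 / C * \<alpha>) < T g x}" by simp
        qed
      qed
      also have "\<dots> \<le> ennreal K * (SUP j::nat. ennreal (2 powr (0 * real j)) * distribution \<mu> (T g) (1 / C * 2 ^ j * \<alpha>))"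
        by (intro mult_left_mono SUP_upper2[of 0]) auto
      finally show "distribution \<nu> (T' f) \<alpha> \<le> \<dots>" .
    qed
    also have "\<dots> \<le> ennreal Q * (ennreal (max M 0) * (ennreal (max L 0) * lorentz_norm \<nu> p r ?f))"
      by (intro mult_left_mono order_trans[OF Mg] mult_mono order_trans[OF le] mult_right_mono ennreal_leI) auto
    also have "\<dots> = ennreal (Q * (max M 0 * max L 0)) * lorentz_norm \<nu> p r ?f"
      using Q(1) by (simp add: ennreal_mult mult.assoc)
    finally show ?thesis .
  qed
  then show ?thesis unfolding lorentz_bounded_def by blast
qed

end

subsection \<open>Unboundedness on \<open>L\<^sup>1\<^sup>,\<^sup>r\<close>\<close>

text \<open>It suffices that \<open>a\<close> is no atom. A geodesic towards \<open>b\<close> gives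
  a point at any small distance \<open>t\<close> from \<open>a\<close>. Its ball of radius
  \<open>2 * t\<close> contains \<open>a\<close>, so doubling twice gives its ball of radius
  \<open>t / 2\<close>, which misses \<open>a\<close>, at least \<open>1 / D\<^sup>2\<close> of the
  mass of the atom. Small balls about \<open>a\<close> would then exceed the atom by a fixed amount,
  against continuity from above.\<close>

lemma small_balls:
  fixes \<mu> :: "'a::metric_space measure" and a b :: 'a
  assumes \<mu>: "metric_measure_space \<mu>" and geo: "geodesic_space TYPE('a)"
    and dbl: "locally_doubling \<mu>" and "a \<noteq> b" and "0 < \<epsilon>"
  obtains \<rho> where "0 < \<rho>" "\<rho> \<le> 1" "emeasure \<mu> (ball a \<rho>) < \<epsilon>"
proof -
  have sets: "sets \<mu> = sets borel" using \<mu> by (simp add: metric_measure_space_def)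
  define B where "B n = ball a (1 / real (Suc n))" for n
  have fin: "emeasure \<mu> (B n) < \<infinity>" for n using \<mu> by (simp add: metric_measure_space_def B_def)
  have "decseq B" unfolding B_def by (intro decseq_SucI subset_ball) (simp add: field_simps)
  have "(\<Inter>n. B n) = {a}"
  proof (intro set_eqI iffI)
    fix x assume x: "x \<in> (\<Inter>n. B n)"
    show "x \<in> {a}"
    proof (rule ccontr)
      assume "x \<notin> {a}"
      then obtain n where "1 / real (Suc n) < dist a x" using nat_approx_posE[of "dist a x"] by auto
      moreover have "x \<in> B n" using x by blast
      ultimately show False by (simp add: B_def)
    qed
  qed (simp add: B_def)
  have lim: "(\<lambda>n. emeasure \<mu> (B n)) \<longlonglongrightarrow> emeasure \<mu> {a}"
  proof -
    have "range B \<subseteq> sets \<mu>" by (auto simp: B_def sets)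
    then show ?thesis
      using Lim_emeasure_decseq[of B \<mu>] \<open>decseq B\<close> \<open>(\<Inter>n. B n) = {a}\<close> fin by (simp add: less_top)
  qed
  obtain D0 :: real where D0: "\<And>x r. 0 < r \<Longrightarrow> r \<le> 1 \<Longrightarrow>
      emeasure \<mu> (ball x (2 * r)) \<le> ennreal D0 * emeasure \<mu> (ball x r)"
    using dbl unfolding locally_doubling_def by (meson zero_less_one)
  define D where "D = max D0 1"
  have D: "0 < D" "\<And>x r. 0 < r \<Longrightarrow> r \<le> 1 \<Longrightarrow> emeasure \<mu> (ball x (2 * r)) \<le> ennreal D * emeasure \<mu> (ball x r)"
    by (auto simp: D_def intro!: order_trans[OF D0] mult_right_mono ennreal_leI)
  have "emeasure \<mu> {a} < \<infinity>"
    using emeasure_mono[of "{a}" "B 0" \<mu>] fin[of 0] by (auto simp: B_def sets intro: le_less_trans)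
  then obtain l where l: "emeasure \<mu> {a} = ennreal l" "0 \<le> l" by (cases "emeasure \<mu> {a}") auto
  have "l = 0"
  proof (rule ccontr)
    assume "l \<noteq> 0"
    then have "0 < l" using l(2) by simp
    have lower: "ennreal (l + l / D\<^sup>2) \<le> emeasure \<mu> (ball a (2 * t))" if t: "0 < t" "t \<le> 1" "t \<le> dist a b" for t
    proof -
      obtain \<gamma> where "geodesic_segment \<gamma> a b" using geo by (auto simp: geodesic_space_def)
      then have "\<gamma> 0 = a" and iso: "\<And>s t. s \<in> {0..dist a b} \<Longrightarrow> t \<in> {0..dist a b} \<Longrightarrow> dist (\<gamma> s) (\<gamma> t) = \<bar>s - t\<bar>"
        by (auto simp: geodesic_segment_def)
      then have z: "dist a (\<gamma> t) = t" using iso[of 0 t] t by auto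
      have "emeasure \<mu> {a} \<le> emeasure \<mu> (ball (\<gamma> t) (2 * t))"
        using z t by (intro emeasure_mono) (auto simp: sets dist_commute)
      also have "\<dots> \<le> ennreal D * emeasure \<mu> (ball (\<gamma> t) (2 * (t / 2)))" using D(2)[of t] t by simp
      also have "\<dots> \<le> ennreal D * (ennreal D * emeasure \<mu> (ball (\<gamma> t) (t / 2)))"
        using t by (intro mult_left_mono D(2)) auto
      finally have "ennreal (1 / D\<^sup>2) * ennreal l \<le> ennreal (1 / D\<^sup>2) * (ennreal (D\<^sup>2) * emeasure \<mu> (ball (\<gamma> t) (t / 2)))"
        using D(1) by (intro mult_left_mono) (simp_all add: l(1) power2_eq_square ennreal_mult' mult.assoc)
      also have "\<dots> = emeasure \<mu> (ball (\<gamma> t) (t / 2))"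
        using D(1) by (simp add: mult.assoc[symmetric] ennreal_mult'[symmetric])
      finally have *: "ennreal (l / D\<^sup>2) \<le> emeasure \<mu> (ball (\<gamma> t) (t / 2))"
        using D(1) by (simp add: ennreal_mult'[symmetric])
      have "ennreal (l + l / D\<^sup>2) = emeasure \<mu> {a} + ennreal (l / D\<^sup>2)"
        using l D(1) by (simp add: ennreal_plus)
      also have "\<dots> \<le> emeasure \<mu> {a} + emeasure \<mu> (ball (\<gamma> t) (t / 2))" by (intro add_left_mono *)
      also have "\<dots> = emeasure \<mu> ({a} \<union> ball (\<gamma> t) (t / 2))"
        using z t by (intro plus_emeasure) (auto simp: sets dist_commute)
      also have "\<dots> \<le> emeasure \<mu> (ball a (2 * t))"
      proof (intro emeasure_mono)
        have "dist a x < 2 * t" if "dist (\<gamma> t) x < t / 2" for x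
          using dist_triangle[of a x "\<gamma> t"] that z t by simp
        then show "{a} \<union> ball (\<gamma> t) (t / 2) \<subseteq> ball a (2 * t)" using t by auto
      qed (simp add: sets)
      finally show ?thesis .
    qed
    have "ennreal (l + l / D\<^sup>2) \<le> emeasure \<mu> (B n)" for n
    proof -
      define t where "t = min (1 / (2 * real (Suc n))) (min 1 (dist a b))"
      have "t \<le> 1 / (2 * real (Suc n))" by (simp add: t_def)
      then have "2 * t \<le> 1 / real (Suc n)" by (simp add: field_simps)
      moreover have "0 < t" "t \<le> 1" "t \<le> dist a b" using \<open>a \<noteq> b\<close> by (auto simp: t_def)
      ultimately show ?thesis
        unfolding B_def by (intro order_trans[OF lower[of t]] emeasure_mono subset_ball) (auto simp: sets)
    qed
    then have "ennreal (l + l / D\<^sup>2) \<le> ennreal l"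
      using lim unfolding l(1) by (intro LIMSEQ_le_const) auto
    moreover have "0 < l / D\<^sup>2" using \<open>0 < l\<close> D(1) by simp
    ultimately show False using \<open>0 < l\<close> by (simp add: ennreal_le_iff del: ennreal_plus)
  qed
  then have "(\<lambda>n. emeasure \<mu> (B n)) \<longlonglongrightarrow> 0" using lim l by simp
  then have "eventually (\<lambda>n. emeasure \<mu> (B n) < \<epsilon>) sequentially" using \<open>0 < \<epsilon>\<close> by (rule order_tendstoD)
  then obtain n where "emeasure \<mu> (B n) < \<epsilon>" by (auto simp: eventually_sequentially)
  then show thesis by (intro that[of "1 / real (Suc n)"]) (auto simp: B_def field_simps)
qed

text \<open>A truncation of the standard function in weak \<open>L\<^sup>1\<close> that is not locally integrable.\<close>

lemma weak_type_extremal: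
  fixes \<mu> :: "'a::metric_space measure"
  assumes \<mu>: "metric_measure_space \<mu>"
    and small: "\<And>\<epsilon>. 0 < \<epsilon> \<Longrightarrow> \<exists>\<rho>. 0 < \<rho> \<and> \<rho> \<le> 1 \<and> emeasure \<mu> (ball a \<rho>) < \<epsilon>"
  obtains u :: "'a \<Rightarrow> real" where "\<And>x. 0 \<le> u x" "u \<in> borel_measurable borel"
    "(\<integral>\<^sup>+ x. ennreal (u x) \<partial>\<mu>) = ennreal (real n)" "\<And>x. x \<notin> ball a 1 \<Longrightarrow> u x = 0"
    "\<And>\<alpha>. 0 < \<alpha> \<Longrightarrow> ennreal \<alpha> * distribution \<mu> (\<lambda>x. ennreal (u x)) \<alpha> \<le> 2"
proof -
  have sets[measurable_cong]: "sets \<mu> = sets borel" using \<mu> by (simp add: metric_measure_space_def)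
  have [simp]: "space \<mu> = UNIV" using sets_eq_imp_space_eq[OF sets] by simp
  have pos: "0 < emeasure \<mu> (ball a \<rho>)" "emeasure \<mu> (ball a \<rho>) < \<infinity>" if "0 < \<rho>" for \<rho>
    using \<mu> that by (auto simp: metric_measure_space_def)
  let ?P = "\<lambda>(_::nat) \<rho>. 0 < \<rho> \<and> \<rho> \<le> (1::real)"
  let ?Q = "\<lambda>(_::nat) \<rho> \<rho>'. emeasure \<mu> (ball a \<rho>') < emeasure \<mu> (ball a \<rho>) / 2"
  obtain \<rho> :: "nat \<Rightarrow> real" where \<rho>: "\<And>k. 0 < \<rho> k \<and> \<rho> k \<le> 1"
    "\<And>k. emeasure \<mu> (ball a (\<rho> (Suc k))) < emeasure \<mu> (ball a (\<rho> k)) / 2"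
  proof -
    have "\<exists>\<rho>. \<forall>k. ?P k (\<rho> k) \<and> ?Q k (\<rho> k) (\<rho> (Suc k))"
    proof (rule dependent_nat_choice)
      show "\<exists>x. ?P 0 x" by (intro exI[of _ 1]) auto
      fix x and k :: nat assume "?P k x"
      then have "0 < emeasure \<mu> (ball a x) / 2"
        using pos(1)[of x] by (simp add: ennreal_zero_less_divide)
      from small[OF this] show "\<exists>y. ?P (Suc k) y \<and> ?Q k x y" by auto
    qed
    then show thesis using that by auto
  qed
  define m where "m k = measure \<mu> (ball a (\<rho> k))" for k
  have em: "emeasure \<mu> (ball a (\<rho> k)) = ennreal (m k)" for k
    using pos(2)[of "\<rho> k"] \<rho>(1)[of k] by (simp add: m_def emeasure_eq_ennreal_measure less_top)
  have m: "0 < m k" for k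
    using pos(1)[of "\<rho> k"] \<rho>(1)[of k] by (simp add: em)
  have half: "2 * m (Suc k) \<le> m k" for k
  proof -
    have "ennreal (m (Suc k)) < ennreal (m k / 2)"
      using \<rho>(2)[of k] m[of k] divide_ennreal[of "m k" 2] by (simp add: em)
    then show ?thesis using m[of "Suc k"] by (simp add: ennreal_less_iff)
  qed
  \<comment> \<open>As the measures at least halve, their reciprocals grow geometrically and the
    last one dominates the sum.\<close>
  have geo: "(\<Sum>j\<le>k. 1 / m j) \<le> 2 / m k" for k
  proof (induction k)
    case (Suc k)
    have "2 / m k \<le> 1 / m (Suc k)" using half[of k] m[of k] m[of "Suc k"] by (simp add: field_simps)
    then show ?case using Suc by simp
  qed (use m[of 0] in \<open>simp add: field_simps\<close>)
  define u where "u n x = (\<Sum>k<n. indicator (ball a (\<rho> k)) x / m k)" for n and x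
  \<comment> \<open>The last ball containing \<open>x\<close> decides: the terms up to its index sum
    to at most \<open>2 / m k\<close>, and later terms vanish at \<open>x\<close>.\<close>
  have level: "\<exists>k<n. x \<in> ball a (\<rho> k) \<and> \<alpha> < 2 / m k" if "\<alpha> < u n x" "0 < \<alpha>" for n x and \<alpha> :: real
    using that
  proof (induction n)
    case (Suc n)
    show ?case
    proof (cases "x \<in> ball a (\<rho> n)")
      case True
      have "u (Suc n) x \<le> (\<Sum>j\<le>n. 1 / m j)"
        unfolding u_def lessThan_Suc_atMost by (intro sum_mono divide_right_mono) (auto simp: indicator_def less_imp_le[OF m])
      then show ?thesis using True geo[of n] Suc.prems by (intro exI[of _ n]) auto
    next
      case False
      then have "u (Suc n) x = u n x" by (simp add: u_def)
      then show ?thesis using Suc by (auto intro: less_SucI)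
    qed
  qed (simp add: u_def)
  have meas[measurable]: "u n \<in> borel_measurable borel" unfolding u_def by measurable
  have nonneg: "0 \<le> u n x" for x unfolding u_def by (intro sum_nonneg) (simp add: less_imp_le[OF m])
  show thesis
  proof (rule that[of "u n"])
    have "(\<integral>\<^sup>+ x. ennreal (u n x) \<partial>\<mu>) = (\<integral>\<^sup>+ x. (\<Sum>k<n. ennreal (1 / m k) * indicator (ball a (\<rho> k)) x) \<partial>\<mu>)"
    proof (intro nn_integral_cong)
      fix x
      have "ennreal (u n x) = (\<Sum>k<n. ennreal (indicator (ball a (\<rho> k)) x / m k))"
        unfolding u_def by (rule sum_ennreal[symmetric]) (simp add: less_imp_le[OF m])
      also have "\<dots> = (\<Sum>k<n. ennreal (1 / m k) * indicator (ball a (\<rho> k)) x)"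
        by (intro sum.cong) (auto simp: indicator_def)
      finally show "ennreal (u n x) = \<dots>" .
    qed
    also have "\<dots> = (\<Sum>k<n. ennreal (1 / m k) * ennreal (m k))"
    proof (subst nn_integral_sum)
      show "(\<Sum>k<n. \<integral>\<^sup>+ x. ennreal (1 / m k) * indicator (ball a (\<rho> k)) x \<partial>\<mu>) =
          (\<Sum>k<n. ennreal (1 / m k) * ennreal (m k))"
        by (intro sum.cong refl) (simp add: nn_integral_cmult em)
    qed measurable
    also have "\<dots> = (\<Sum>k<n. 1)"
    proof (intro sum.cong refl)
      fix k
      show "ennreal (1 / m k) * ennreal (m k) = 1"
        using m[of k] by (simp add: ennreal_mult[symmetric])
    qed
    finally show "(\<integral>\<^sup>+ x. ennreal (u n x) \<partial>\<mu>) = ennreal (real n)"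
      by (simp add: ennreal_of_nat_eq_real_of_nat)
    show "u n x = 0" if "x \<notin> ball a 1" for x
    proof -
      have "x \<notin> ball a (\<rho> k)" for k using that \<rho>(1)[of k] by auto
      then show ?thesis by (simp add: u_def del: mem_ball)
    qed
    fix \<alpha> :: real assume \<alpha>: "0 < \<alpha>"
    \<comment> \<open>Indices whose balls can cover points at height \<alpha>. The balls are
      concentric, so the one of largest radius contains the whole superlevel set, and membership in
      \<open>J\<close> gives \<open>\<alpha> * m k < 2\<close>.\<close>
    define J where "J = {k. k < n \<and> \<alpha> < 2 / m k}"
    show "ennreal \<alpha> * distribution \<mu> (\<lambda>x. ennreal (u n x)) \<alpha> \<le> 2"
    proof (cases "J = {}")
      case True
      then have "{x \<in> space \<mu>. ennreal \<alpha> < ennreal (u n x)} = {}"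
        using level[of \<alpha> n] \<alpha> by (auto simp: J_def ennreal_less_iff)
      then show ?thesis by (simp only: emeasure_empty) simp
    next
      case False
      have "finite J" by (simp add: J_def)
      have "Max (\<rho> ` J) \<in> \<rho> ` J" using False \<open>finite J\<close> by (intro Max_in) auto
      then obtain k where k: "k \<in> J" "\<rho> k = Max (\<rho> ` J)" by auto
      have "{x \<in> space \<mu>. ennreal \<alpha> < ennreal (u n x)} \<subseteq> ball a (\<rho> k)"
      proof clarsimp
        fix x assume "ennreal \<alpha> < ennreal (u n x)"
        then obtain i where i: "i < n" "x \<in> ball a (\<rho> i)" "\<alpha> < 2 / m i"
          using level[of \<alpha> n x] \<alpha> by (auto simp: ennreal_less_iff)
        then have "\<rho> i \<le> \<rho> k" unfolding k(2) using \<open>finite J\<close> by (intro Max_ge) (auto simp: J_def)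
        then show "dist a x < \<rho> k" using i(2) by simp
      qed
      then have "distribution \<mu> (\<lambda>x. ennreal (u n x)) \<alpha> \<le> ennreal (m k)"
        unfolding em[symmetric] by (intro emeasure_mono) (auto simp: sets)
      then have "ennreal \<alpha> * distribution \<mu> (\<lambda>x. ennreal (u n x)) \<alpha> \<le> ennreal \<alpha> * ennreal (m k)"
        by (intro mult_left_mono) auto
      also have "\<dots> \<le> ennreal 2"
        using k(1) \<alpha> m[of k] by (simp add: J_def ennreal_mult'[symmetric] field_simps del: ennreal_numeral)
      finally show ?thesis by simp
    qed
  qed (use meas nonneg in auto)
qed

text \<open>Interpolation between weak \<open>L\<^sup>1\<close> and \<open>L\<^sup>1\<close>.\<close>

lemma lorentz_norm_one_le:
  fixes M :: "'a measure" and r :: ennreal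
  assumes "1 < r" and M: "sigma_finite_measure M"
  obtains A \<kappa> :: real where "0 < A" "\<kappa> < 1"
    "\<And>u t. u \<in> borel_measurable M \<Longrightarrow> 0 < t \<Longrightarrow>
      (\<integral>\<^sup>+ x. u x \<partial>M) = ennreal t \<Longrightarrow> (\<And>\<alpha>. 0 < \<alpha> \<Longrightarrow> ennreal \<alpha> * distribution M u \<alpha> \<le> 2) \<Longrightarrow>
      lorentz_norm M 1 r u \<le> ennreal (A * t powr \<kappa>)"
proof (cases r)
  case top
  show thesis
  proof (rule that[of 2 0])
    fix u :: "'a \<Rightarrow> ennreal" and t :: real
    assume "0 < t" and weak: "\<And>\<alpha>. 0 < \<alpha> \<Longrightarrow> ennreal \<alpha> * distribution M u \<alpha> \<le> 2"
    have "lorentz_norm M 1 \<infinity> u \<le> 2" unfolding lorentz_norm_top using weak by (intro SUP_least) auto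
    then show "lorentz_norm M 1 r u \<le> ennreal (2 * t powr 0)" using top \<open>0 < t\<close> by simp
  qed auto
next
  case (real q)
  then have q: "1 < q" using assms by (metis ennreal_1 ennreal_less_iff zero_le_one)
  define c where "c = q * 2 powr (q - 1)"
  have c: "0 < c" using q by (simp add: c_def)
  show thesis
  proof (rule that[of "c powr (1 / q)" "1 / q"])
    fix u :: "'a \<Rightarrow> ennreal" and t :: real
    assume u[measurable]: "u \<in> borel_measurable M" and t: "0 < t"
      and int: "(\<integral>\<^sup>+ x. u x \<partial>M) = ennreal t"
      and weak: "\<And>\<alpha>. 0 < \<alpha> \<Longrightarrow> ennreal \<alpha> * distribution M u \<alpha> \<le> 2"
    have "(\<integral>\<^sup>+ \<alpha>\<in>{0<..}. ennpowr (distribution M u \<alpha>) q * ennreal (\<alpha> powr (q - 1)) \<partial>lborel)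
      \<le> (\<integral>\<^sup>+ \<alpha>. ennreal (2 powr (q - 1)) * (distribution M u \<alpha> * indicator {0<..} \<alpha>) \<partial>lborel)"
    proof (intro nn_integral_mono)
      fix \<alpha> :: real
      show "ennpowr (distribution M u \<alpha>) q * ennreal (\<alpha> powr (q - 1)) * indicator {0<..} \<alpha>
        \<le> ennreal (2 powr (q - 1)) * (distribution M u \<alpha> * indicator {0<..} \<alpha>)"
      proof (cases "0 < \<alpha>")
        case True
        have "distribution M u \<alpha> \<noteq> top" using weak[OF True] True by (auto simp: ennreal_mult_top top_unique)
        then obtain d where d: "distribution M u \<alpha> = ennreal d" "0 \<le> d" by (cases "distribution M u \<alpha>") auto
        have "ennreal (\<alpha> * d) \<le> ennreal 2" using weak[OF True] True d by (simp add: ennreal_mult)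
        then have "\<alpha> * d \<le> 2" by (simp add: ennreal_le_iff del: ennreal_numeral)
        then have "(\<alpha> * d) powr (q - 1) \<le> 2 powr (q - 1)" using True d q by (intro powr_mono2) auto
        \<comment> \<open>All but one power of the distribution function \<open>d\<close> are paired
          with powers of \<alpha> and absorbed by the weak bound; the remaining power integrates to
          \<open>t\<close> by the layer cake formula. The norm thus grows only like
          \<open>t powr (1 / q)\<close>.\<close>
        moreover have "d powr q * \<alpha> powr (q - 1) = (\<alpha> * d) powr (q - 1) * d"
        proof (cases "d = 0")
          case False
          then have "d powr q = d powr (q - 1) * d" using d(2) powr_mult_base[of d "q - 1"] by (simp add: mult.commute)
          then show ?thesis using True d(2) by (simp add: powr_mult)
        qed simp
        ultimately have "d powr q * \<alpha> powr (q - 1) \<le> 2 powr (q - 1) * d"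
          using d(2) by (simp add: mult_right_mono)
        then show ?thesis using True d by (simp add: ennreal_mult[symmetric])
      qed simp
    qed
    also have "\<dots> = ennreal (2 powr (q - 1)) * ennreal t"
      unfolding int[symmetric] nn_integral_eq_nn_integral_distribution[OF M u]
      by (rule nn_integral_cmult) measurable
    finally have "ennreal q * (\<integral>\<^sup>+ \<alpha>\<in>{0<..}. ennpowr (distribution M u \<alpha>) q * ennreal (\<alpha> powr (q - 1)) \<partial>lborel)
      \<le> ennreal q * (ennreal (2 powr (q - 1)) * ennreal t)"
      by (rule mult_left_mono) simp
    also have "\<dots> = ennreal (c * t)" using q t by (simp add: c_def ennreal_mult'[symmetric] mult.assoc)
    finally have "lorentz_norm M 1 r u \<le> ennpowr (ennreal (c * t)) (1 / q)"
      using q unfolding real lorentz_norm_ennreal[OF less_imp_le[OF q]] by (intro ennpowr_mono) auto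
    then show "lorentz_norm M 1 r u \<le> ennreal (c powr (1 / q) * t powr (1 / q))"
      using c t by (simp add: powr_mult)
  qed (use q c in auto)
qed

text \<open>A test function of mass \<open>n\<close> in \<open>ball a 1\<close> has averages at
  least \<open>n / S\<close> over the 2-balls centred there, so \<open>T g\<close> has norm at least
  a multiple of \<open>n\<close>, whatever \<open>s\<close> is. The norm of \<open>g\<close> is only
  of order \<open>n powr \<kappa>\<close> with \<open>\<kappa> < 1\<close>.\<close>

lemma not_lorentz_bounded_one:
  fixes \<mu> :: "'a::metric_space measure" and r s :: ennreal
  assumes \<mu>: "metric_measure_space \<mu>" and size: "uniformly_sized \<mu>"
    and small: "\<And>\<epsilon>. 0 < \<epsilon> \<Longrightarrow> \<exists>\<rho>. 0 < \<rho> \<and> \<rho> \<le> 1 \<and> emeasure \<mu> (ball a \<rho>) < \<epsilon>"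
    and "1 < r" "1 \<le> s"
    and T: "\<And>g. g \<in> borel_measurable borel \<Longrightarrow> T g \<in> borel_measurable borel"
    and avg: "\<And>g x. ball_average \<mu> g x 2 \<le> T g x"
  shows "\<not> lorentz_bounded \<mu> 1 r s T"
proof
  assume "lorentz_bounded \<mu> 1 r s T"
  then obtain C0 :: real where C0: "\<And>g. g \<in> lorentz_space \<mu> 1 r \<Longrightarrow>
      lorentz_norm \<mu> 1 s (T g) \<le> ennreal C0 * lorentz_norm \<mu> 1 r (\<lambda>x. ennreal (norm (g x)))"
    unfolding lorentz_bounded_def by blast
  note sets[measurable_cong] = uniformly_sized_sets[OF size]
  have [simp]: "space \<mu> = UNIV" using sets_eq_imp_space_eq[OF sets] by simp
  obtain c where c: "0 < c" "\<And>x. ennreal c \<le> emeasure \<mu> (ball x 1)"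
    using uniformly_sized_lower[OF size] by blast
  obtain S where S: "0 < S" "\<And>x. emeasure \<mu> (ball x 2) \<le> ennreal S"
    using uniformly_sized_upper[OF size] by blast
  obtain A \<kappa> where A: "0 < A" "\<kappa> < 1" "\<And>u t. u \<in> borel_measurable \<mu> \<Longrightarrow> 0 < t \<Longrightarrow>
      (\<integral>\<^sup>+ x. u x \<partial>\<mu>) = ennreal t \<Longrightarrow> (\<And>\<alpha>. 0 < \<alpha> \<Longrightarrow> ennreal \<alpha> * distribution \<mu> u \<alpha> \<le> 2) \<Longrightarrow>
      lorentz_norm \<mu> 1 r u \<le> ennreal (A * t powr \<kappa>)"
    using lorentz_norm_one_le[OF \<open>1 < r\<close> uniformly_sized_sigma_finite[OF size]] by blast
  define C where "C = max C0 0"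
  have growth: "real n * (c / (2 * S)) \<le> C * A * real n powr \<kappa>" if n: "0 < n" for n :: nat
  proof -
    obtain u where u: "\<And>x. 0 \<le> u x" and [measurable]: "u \<in> borel_measurable borel"
      and int: "(\<integral>\<^sup>+ x. ennreal (u x) \<partial>\<mu>) = ennreal (real n)" and supp: "\<And>x. x \<notin> ball a 1 \<Longrightarrow> u x = 0"
      and weak: "\<And>\<alpha>. 0 < \<alpha> \<Longrightarrow> ennreal \<alpha> * distribution \<mu> (\<lambda>x. ennreal (u x)) \<alpha> \<le> 2"
      using weak_type_extremal[OF \<mu> small, of n] by blast
    define g where "g x = complex_of_real (u x)" for x
    have norm_g: "norm (g x) = u x" for x using u by (simp add: g_def)
    have [measurable]: "g \<in> borel_measurable borel" unfolding g_def by measurable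
    have norm_le: "lorentz_norm \<mu> 1 r (\<lambda>x. ennreal (u x)) \<le> ennreal (A * real n powr \<kappa>)"
      using n by (intro A(3) int weak) (auto simp: measurable_cong_sets[OF sets])
    then have "g \<in> lorentz_space \<mu> 1 r"
      by (auto simp: lorentz_space_def norm_g measurable_cong_sets[OF sets] intro: le_less_trans)
    from C0[OF this] have "lorentz_norm \<mu> 1 s (T g) \<le> ennreal C * ennreal (A * real n powr \<kappa>)"
      unfolding norm_g C_def by (rule order_trans) (intro mult_mono norm_le ennreal_leI, auto)
    moreover have "ennreal (real n * (c / (2 * S))) \<le> lorentz_norm \<mu> 1 s (T g)"
    proof -
      have [measurable]: "T g \<in> borel_measurable borel" by (rule T) measurable
      define t where "t = real n / (2 * S)"
      have t: "0 < t" using n S(1) by (simp add: t_def)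
      have "ball a 1 \<subseteq> {x \<in> space \<mu>. ennreal t < T g x}"
      proof
        fix x assume x: "x \<in> ball a 1"
        have "ball a 1 \<subseteq> ball x 2"
          using x by (auto simp: subset_iff) (smt (verit) dist_triangle dist_commute)
        have "(\<integral>\<^sup>+ y\<in>ball x 2. ennreal (norm (g y)) \<partial>\<mu>) = (\<integral>\<^sup>+ y. ennreal (u y) \<partial>\<mu>)"
        proof (intro nn_integral_cong)
          fix y
          have "y \<in> ball x 2 \<or> u y = 0" using supp[of y] \<open>ball a 1 \<subseteq> ball x 2\<close> by blast
          then show "ennreal (norm (g y)) * indicator (ball x 2) y = ennreal (u y)"
            by (auto simp: norm_g indicator_def)
        qed
        from this have "ennreal (real n) / ennreal S \<le> ball_average \<mu> g x 2"
          unfolding ball_average_def int[symmetric] by (intro ennreal_divide_mono S) simp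
        then have "ennreal (real n / S) \<le> T g x"
          using avg[of g x] S(1) by (simp add: divide_ennreal)
        moreover have "ennreal t < ennreal (real n / S)"
          using n S(1) by (simp add: t_def ennreal_less_iff field_simps)
        ultimately show "x \<in> {x \<in> space \<mu>. ennreal t < T g x}" by simp
      qed
      then have "emeasure \<mu> (ball a 1) \<le> distribution \<mu> (T g) t"
        by (intro emeasure_mono) measurable
      then have "ennreal t * ennreal c \<le> ennreal t * ennpowr (distribution \<mu> (T g) t) (1 / 1)"
        using c(2)[of a] by (intro mult_left_mono) auto
      also have "\<dots> \<le> lorentz_norm \<mu> 1 s (T g)"
        using t \<open>1 \<le> s\<close> by (intro lorentz_norm_Chebyshev) auto
      finally show ?thesis using t by (simp add: ennreal_mult'[symmetric] t_def)
    qed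
    ultimately have "ennreal (real n * (c / (2 * S))) \<le> ennreal C * ennreal (A * real n powr \<kappa>)"
      by (rule order_trans[rotated])
    also have "\<dots> = ennreal (C * A * real n powr \<kappa>)"
      by (simp add: C_def ennreal_mult'[symmetric] mult.assoc)
    finally have "ennreal (real n * (c / (2 * S))) \<le> ennreal (C * A * real n powr \<kappa>)" .
    then show ?thesis using A(1) by (subst (asm) ennreal_le_iff) (auto simp: C_def)
  qed
  \<comment> \<open>Chosen so that \<open>n powr (1 - \<kappa>) > Q\<close> contradicts
    \<open>growth\<close>; the added 1 gives positivity and the final strict inequality.\<close>
  define Q where "Q = C * A * (2 * S / c) + 1"
  have Q: "0 < Q" using A(1) S(1) c(1) by (auto simp: Q_def C_def intro!: add_nonneg_pos)
  obtain n :: nat where "Q powr (1 / (1 - \<kappa>)) < real n" using reals_Archimedean2 by blast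
  moreover have "0 < Q powr (1 / (1 - \<kappa>))" using Q by simp
  ultimately have n: "0 < n" "Q powr (1 / (1 - \<kappa>)) < real n" by linarith+
  have "Q = (Q powr (1 / (1 - \<kappa>))) powr (1 - \<kappa>)" using Q A(2) by (simp add: powr_powr)
  also have "\<dots> < real n powr (1 - \<kappa>)" using n A(2) by (intro powr_less_mono2) auto
  finally have "Q * real n powr \<kappa> < real n powr (1 - \<kappa>) * real n powr \<kappa>"
    using n(1) by (intro mult_strict_right_mono) auto
  also have "\<dots> = real n" using n(1) by (simp add: powr_add[symmetric])
  also have "\<dots> \<le> C * A * (2 * S / c) * real n powr \<kappa>"
    using growth[OF n(1)] c(1) S(1) by (simp add: field_simps)
  also have "\<dots> < Q * real n powr \<kappa>" using n(1) unfolding Q_def distrib_right by simp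
  finally show False .
qed

subsection \<open>Strict quasi-isometries\<close>

lemma rough_isometry_quasi_inverse:
  assumes "uniformly_sized \<mu>" "uniformly_sized \<nu>" "strict_quasi_isometry \<phi>"
  obtains \<psi> \<beta> where "rough_isometry \<mu> \<nu> \<phi> \<psi> \<beta>"
proof -
  obtain \<beta>0 where \<beta>0: "0 \<le> \<beta>0" "\<And>x y. dist x y \<le> dist (\<phi> x) (\<phi> y) + \<beta>0" "\<And>x y. dist (\<phi> x) (\<phi> y) \<le> dist x y + \<beta>0"
    using assms(3) unfolding strict_quasi_isometry_def by (metis diff_le_eq)
  obtain c where c: "\<And>a. infdist a (range \<phi>) \<le> c"
    using assms(3) by (auto simp: strict_quasi_isometry_def bdd_above_def)
  have "\<exists>x. dist (\<phi> x) a < c + 1" for a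
  proof -
    have "(INF y\<in>range \<phi>. dist a y) < c + 1"
      using c[of a] by (simp add: infdist_notempty)
    then show ?thesis
      using cInf_lessD[of "dist a ` range \<phi>" "c + 1"] by (auto simp: dist_commute)
  qed
  then obtain \<psi> where \<psi>: "\<And>a. dist (\<phi> (\<psi> a)) a < c + 1" by metis
  have "0 < c + 1" using order.strict_trans1[OF zero_le_dist \<psi>] by blast
  \<comment> \<open>The infimum distance to the range need not be attained, hence
    \<open>c + 1\<close>. It is counted twice because both endpoints move when \<open>a\<close> and
    \<open>b\<close> are replaced by \<open>\<phi> (\<psi> a)\<close> and
    \<open>\<phi> (\<psi> b)\<close>.\<close>
  have "rough_isometry \<mu> \<nu> \<phi> \<psi> (\<beta>0 + 2 * (c + 1))"
  proof
    fix x y show "dist x y \<le> dist (\<phi> x) (\<phi> y) + (\<beta>0 + 2 * (c + 1))"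
      and "dist (\<phi> x) (\<phi> y) \<le> dist x y + (\<beta>0 + 2 * (c + 1))"
      using \<beta>0(2,3)[of x y] \<open>0 < c + 1\<close> by auto
  next
    fix a b
    have "\<bar>dist (\<phi> (\<psi> a)) (\<phi> (\<psi> b)) - dist a b\<bar> \<le> 2 * (c + 1)"
      using \<psi>[of a] \<psi>[of b] by (smt (verit) dist_triangle dist_commute)
    then show "dist a b \<le> dist (\<psi> a) (\<psi> b) + (\<beta>0 + 2 * (c + 1))"
      and "dist (\<psi> a) (\<psi> b) \<le> dist a b + (\<beta>0 + 2 * (c + 1))"
      using \<beta>0(2,3)[of "\<psi> a" "\<psi> b"] by auto
  next
    fix a show "dist (\<phi> (\<psi> a)) a \<le> \<beta>0 + 2 * (c + 1)"
      using \<psi>[of a] \<beta>0(1) \<open>0 < c + 1\<close> by simp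
  qed (use assms \<beta>0(1) \<open>0 < c + 1\<close> in auto)
  then show thesis by (rule that)
qed

lemma ball_average_le_centred_maximal: "ball_average \<mu> f x 2 \<le> centred_maximal \<mu> f x"
  unfolding centred_maximal_def by (intro SUP_upper) simp

lemma ball_average_le_uncentred_maximal: "ball_average \<mu> f x 2 \<le> uncentred_maximal \<mu> f x"
  unfolding uncentred_maximal_def by (intro SUP_upper2[of "(x, 2)"]) auto

theorem theorem5p5:
  fixes \<mu> :: "'a::metric_space measure" and \<mu>' :: "'b::metric_space measure"
    and \<phi> :: "'a \<Rightarrow> 'b" and p :: real and r s :: ennreal
  assumes "metric_measure_space \<mu>" and "metric_measure_space \<mu>'"
    and "geodesic_space TYPE('a)" and "geodesic_space TYPE('b)"
    and "locally_doubling \<mu>" and "locally_doubling \<mu>'"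
    and "uniform_ball_size \<mu>" and "uniform_ball_size \<mu>'"
    and "strict_quasi_isometry \<phi>"
    and "1 \<le> p" and "1 \<le> r" and "r \<le> s"
    \<comment> \<open>Excludes only the case where \<open>X\<close> is a point, \<open>X'\<close> is not, \<open>p = 1\<close> and \<open>r > 1\<close>. There the
      claim is false: on a point the operators are \<open>f \<mapsto> \<bar>f\<bar>\<close>, while on \<open>X'\<close> they are infinite
      at some functions of \<open>L\<^sup>1\<^sup>,\<^sup>r\<close> that are not integrable.\<close>
    and "p = 1 \<and> 1 < r \<and> (\<exists>a b::'b. a \<noteq> b) \<longrightarrow> (\<exists>a b::'a. a \<noteq> b)"
  shows "(lorentz_bounded \<mu> p r s (centred_maximal \<mu>) \<longrightarrow>
            lorentz_bounded \<mu>' p r s (centred_maximal \<mu>')) \<and>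
         (lorentz_bounded \<mu> p r s (uncentred_maximal \<mu>) \<longrightarrow>
            lorentz_bounded \<mu>' p r s (uncentred_maximal \<mu>'))"
proof -
  have size: "uniformly_sized \<mu>" "uniformly_sized \<mu>'"
    using assms by (auto intro: uniformly_sizedI)
  have "1 \<le> s" using assms(11,12) by (rule order_trans)
  note sets = uniformly_sized_sets[OF size(1)]
  show ?thesis
  proof (cases "1 < p \<or> r = 1 \<or> (\<forall>a b::'b. a = b)")
    case True
    obtain \<psi> \<beta> where "rough_isometry \<mu> \<mu>' \<phi> \<psi> \<beta>"
      using rough_isometry_quasi_inverse[OF size assms(9)] by blast
    then interpret rough_isometry \<mu> \<mu>' \<phi> \<psi> \<beta> .
    obtain C1 where C1: "0 < C1" "\<And>f g a x. f \<in> borel_measurable borel \<Longrightarrow>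
        (\<And>w. ennreal (norm (g w)) = pullback (\<lambda>y. ennreal (norm (f y))) w) \<Longrightarrow>
        dist (\<psi> a) x < 1 \<Longrightarrow> centred_maximal \<mu>' f a \<le> ennreal C1 * centred_maximal \<mu> g x"
      using centred_maximal_le_pullback[OF assms(4)] by blast
    obtain C2 where C2: "0 < C2" "\<And>f g a x. f \<in> borel_measurable borel \<Longrightarrow>
        (\<And>w. ennreal (norm (g w)) = pullback (\<lambda>y. ennreal (norm (f y))) w) \<Longrightarrow>
        dist (\<psi> a) x < 1 \<Longrightarrow> uncentred_maximal \<mu>' f a \<le> ennreal C2 * uncentred_maximal \<mu> g x"
      using uncentred_maximal_le_pullback[OF assms(4)] by blast
    show ?thesis
    proof (intro conjI impI)
      assume bdd: "lorentz_bounded \<mu> p r s (centred_maximal \<mu>)"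
      show "lorentz_bounded \<mu>' p r s (centred_maximal \<mu>')"
        by (rule lorentz_bounded_transfer[OF assms(10,11) \<open>1 \<le> s\<close> C1(1) _ _ True bdd])
           (fact measurable_centred_maximal[OF sets], fact C1(2))
    next
      assume bdd: "lorentz_bounded \<mu> p r s (uncentred_maximal \<mu>)"
      show "lorentz_bounded \<mu>' p r s (uncentred_maximal \<mu>')"
        by (rule lorentz_bounded_transfer[OF assms(10,11) \<open>1 \<le> s\<close> C2(1) _ _ True bdd])
           (rule measurable_uncentred_maximal, fact C2(2))
    qed
  next
    \<comment> \<open>Here \<open>p = 1 < r\<close> and \<open>X'\<close> is not a point, so by the
      last assumption neither is \<open>X\<close>. Both implications then hold because neither
      operator is bounded on \<open>X\<close>.\<close>
    case False
    then have p: "p = 1" and r: "1 < r" using assms(10,11) by auto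
    then obtain a b :: 'a where ab: "a \<noteq> b" using False assms(13) by blast
    have small: "\<exists>\<rho>. 0 < \<rho> \<and> \<rho> \<le> 1 \<and> emeasure \<mu> (ball a \<rho>) < \<epsilon>" if "0 < \<epsilon>" for \<epsilon>
      using small_balls[OF assms(1,3,5) ab that] by blast
    show ?thesis
      unfolding p
      using not_lorentz_bounded_one[OF assms(1) size(1) small r \<open>1 \<le> s\<close>]
        measurable_centred_maximal[OF sets] measurable_uncentred_maximal
        ball_average_le_centred_maximal ball_average_le_uncentred_maximal by blast
  qed
qed

end
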